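(* Let $X=[0,1]^d$ for some $d\in\mathbb{N}$, with the Euclidean metric. (1) For all $0<b<B\le d$ there exists a compact set $C\subseteq X$ such that $\underline{\dim}_{\mathrm B}C=b<B=\overline{\dim}_{\mathrm B}C$ and $p_t(C)=0$ for all $t\ge b$. (2) For all $0<b<B\le d$ there exists a compact set $C\subseteq X$ such that $\underline{\dim}_{\mathrm B}C=b<B=\overline{\dim}_{\mathrm B}C$ and $$p_t(C)=\frac{b}{t}\,\frac{d-t}{d-b}$$ for all $t\in(b,B)$. In particular, for such a $C$ the upper bound $$p_t(C)\le\frac{\underline{\dim}_{\mathrm B}C}{t}\,\frac{\overline{\dim}_{\mathrm B}X-t}{\overline{\dim}_{\mathrm B}X-\underline{\dim}_{\mathrm B}C},\qquad t\in(\underline{\dim}_{\mathrm B}C,\overline{\dim}_{\mathrm B}C)$$ (valid for non-empty compact subsets $C$ of compact Ahlfors regular spaces $X$) is attained with equality, i.e. this bound is sharp.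
   Context: For a non-empty set $E\subseteq X$ and $\delta>0$, $N_\delta(E)$ is the minimum number of sets of diameter at most $\delta$ required to cover $E$; $\underline{\dim}_{\mathrm B}E$ and $\overline{\dim}_{\mathrm B}E$ are the $\liminf$ and $\limsup$, respectively, of $\frac{\log N_\delta(E)}{-\log\delta}$ as $\delta\to0$. Covering regularity exponents: for non-empty compact $C\subseteq X$, $t\ge0$ and $\delta\in(0,1]$, $p_{t,\delta}(C)=\sup\{p\in[0,1]:N_{\delta^p}(C)\ge\delta^{-pt}\}$, and $p_t(C)=\liminf_{\delta\to0}p_{t,\delta}(C)$. A metric space $X$ is Ahlfors regular if $\dim_{\mathrm H}X<\infty$ and there is $\lambda>0$ such that $\tfrac1\lambda r^{\dim_{\mathrm H}X}\le\mathcal{H}^{\dim_{\mathrm H}X}(B(x,r))\le\lambda r^{\dim_{\mathrm H}X}$ for all $x\in X$ and $0<r\le\mathrm{diam}(X)$, where $B(x,r)$ is the open ball and $\mathcal{H}^{\dim_{\mathrm H}X}$ is Hausdorff measure in dimension $\dim_{\mathrm H}X$; the cube $[0,1]^d$ is Ahlfors regular with $\overline{\dim}_{\mathrm B}X=d$. *)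

theory Defs
  imports "HOL-Analysis.Analysis"
begin

text \<open>
  Boundedness is required separately because \<^const>\<open>diameter\<close> is a real supremum, hence
  unspecified on unbounded sets.  The covering sets need not lie in an ambient space
  \<open>X \<supseteq> E\<close>: intersecting them with \<open>X\<close> does not increase diameters, so the minimum is the same
  relative to any \<open>X\<close>.  The minimum exists when \<open>E\<close> is totally bounded and \<open>\<delta> > 0\<close>.
\<close>

definition covering_number :: "real \<Rightarrow> 'a::metric_space set \<Rightarrow> nat" where
  "covering_number \<delta> E =
     (LEAST n. \<exists>\<U>. finite \<U> \<and> card \<U> = n \<and> E \<subseteq> \<Union>\<U> \<and>
                   (\<forall>U\<in>\<U>. bounded U \<and> diameter U \<le> \<delta>))"

definition lower_box_dim :: "'a::metric_space set \<Rightarrow> ereal" where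
  "lower_box_dim E =
     Liminf (at_right 0) (\<lambda>\<delta>. ereal (ln (real (covering_number \<delta> E)) / (- ln \<delta>)))"

definition upper_box_dim :: "'a::metric_space set \<Rightarrow> ereal" where
  "upper_box_dim E =
     Limsup (at_right 0) (\<lambda>\<delta>. ereal (ln (real (covering_number \<delta> E)) / (- ln \<delta>)))"

text \<open>
  For non-empty \<open>C\<close> the set below contains \<open>p = 0\<close> and is bounded by \<open>1\<close>, so the real supremum
  is the intended one.
\<close>

definition cov_reg_exponent_at :: "real \<Rightarrow> real \<Rightarrow> 'a::metric_space set \<Rightarrow> real" where
  "cov_reg_exponent_at t \<delta> C =
     Sup {p \<in> {0..1}. real (covering_number (\<delta> powr p) C) \<ge> \<delta> powr (- (p * t))}"

definition cov_reg_exponent :: "real \<Rightarrow> 'a::metric_space set \<Rightarrow> ereal" where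
  "cov_reg_exponent t C = Liminf (at_right 0) (\<lambda>\<delta>. ereal (cov_reg_exponent_at t \<delta> C))"

end

theory Submission
  imports Defs
begin

text \<open>
  Put \<open>\<delta> = exp (- x)\<close> and \<open>L x = ln N\<^sub>\<delta>(C)\<close>.  The box dimensions of \<open>C\<close> are the lower and upper limits
  of \<open>L x / x\<close>, and \<open>p\<^sub>t\<close> records how far back from \<open>x\<close> one must go, as a proportion of \<open>x\<close>, to find a
  point where \<open>L\<close> is on or above the line of slope \<open>t\<close>.  So everything depends on the shape of the
  function \<open>L\<close>, and for subsets of the cube of dimension \<open>d\<close> the possible shapes are known: up to a
  bounded error, \<open>L\<close> is non-decreasing with slope at most \<open>d\<close> (\<open>log_covering_growth\<close>), and
  conversely every such function that vanishes at \<open>0\<close> occurs (\<open>exists_set_with_profile\<close>), for the set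
  of points whose binary digits are free at prescribed positions and zero elsewhere.

  The general upper bound (\<open>regularity_upper_bound\<close>) comes from a point \<open>x\<close> with \<open>L x\<close> about \<open>b x\<close>:
  by monotonicity \<open>L\<close> is below the line of slope \<open>t\<close> since \<open>b x / t\<close>, and because of the slope \<open>d\<close> it
  needs until \<open>(d - b) x / (d - t)\<close> to return to that line.  The bound is the ratio of these two points.

  For the examples, take the largest non-decreasing function with slope at most \<open>d\<close> that is at most
  \<open>B x\<close> everywhere and at most \<open>b x\<close> on a set \<open>A\<close> (locale \<open>pinned_profile\<close>).  If \<open>A\<close> is unbounded, the
  lower dimension is \<open>b\<close>; if \<open>A\<close> has gaps of unbounded ratio, the upper dimension is \<open>B\<close>.  If \<open>A\<close> is
  sparse, here the set of factorials, then below the line of slope \<open>B\<close> the function is constant before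
  a point of \<open>A\<close> and climbs with slope \<open>d\<close> after it.  This is the extreme case in the proof of the
  upper bound, which therefore becomes an equality (\<open>regularity_lower_bound\<close>).  If \<open>A\<close> contains
  intervals of unbounded ratio, the function follows the line of slope \<open>b\<close> for so long that the exponents tend to \<open>0\<close> along their
  right endpoints (\<open>regularity_vanishes\<close>).
\<close>

section \<open>Covering numbers\<close>

definition covers :: "real \<Rightarrow> 'a::metric_space set \<Rightarrow> 'a set set \<Rightarrow> bool" where
  "covers \<delta> E \<U> \<longleftrightarrow> finite \<U> \<and> E \<subseteq> \<Union>\<U> \<and> (\<forall>U\<in>\<U>. bounded U \<and> diameter U \<le> \<delta>)"

lemma covering_number_le:
  assumes "covers \<delta> E \<U>"
  shows "covering_number \<delta> E \<le> card \<U>"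
  unfolding covering_number_def
  by (rule Least_le) (use assms in \<open>auto simp: covers_def\<close>)

lemma covering_number_attained:
  assumes "covers \<delta> E \<U>"
  obtains \<V> where "covers \<delta> E \<V>" "card \<V> = covering_number \<delta> E"
proof -
  let ?P = "\<lambda>n. \<exists>\<U>. finite \<U> \<and> card \<U> = n \<and> E \<subseteq> \<Union>\<U> \<and> (\<forall>U\<in>\<U>. bounded U \<and> diameter U \<le> \<delta>)"
  have "?P (card \<U>)"
    using assms by (auto simp: covers_def)
  then have "?P (LEAST n. ?P n)"
    by (rule LeastI)
  then show ?thesis
    using that by (auto simp: covers_def covering_number_def)
qed

lemma covering_number_mono:
  assumes "covers \<delta> E \<U>" "\<delta> \<le> \<delta>'" "E' \<subseteq> E"
  shows "covering_number \<delta>' E' \<le> covering_number \<delta> E"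
proof -
  obtain \<V> where \<V>: "covers \<delta> E \<V>" "card \<V> = covering_number \<delta> E"
    using covering_number_attained assms(1) by blast
  then have "covers \<delta>' E' \<V>"
    using assms(2,3) unfolding covers_def by force
  then show ?thesis
    using covering_number_le \<V> by metis
qed

text \<open>
  A set of diameter at most \<open>\<delta>\<close> contains at most one point of a \<open>\<delta>\<close>-separated set.  All lower
  bounds on covering numbers below come from this.
\<close>

lemma card_separated_le_covering_number:
  assumes "covers \<delta> E \<U>" "P \<subseteq> E"
    and sep: "\<And>x y. \<lbrakk>x \<in> P; y \<in> P; x \<noteq> y\<rbrakk> \<Longrightarrow> \<delta> < dist x y"
  shows "card P \<le> covering_number \<delta> E"
proof -
  obtain \<V> where \<V>: "covers \<delta> E \<V>" "card \<V> = covering_number \<delta> E"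
    using covering_number_attained assms(1) by blast
  have "\<forall>x\<in>P. \<exists>U\<in>\<V>. x \<in> U"
    using \<V> assms(2) by (auto simp: covers_def)
  then obtain f where f: "\<And>x. x \<in> P \<Longrightarrow> f x \<in> \<V> \<and> x \<in> f x"
    by metis
  have "inj_on f P"
  proof (rule inj_onI, rule ccontr)
    fix x y assume xy: "x \<in> P" "y \<in> P" "f x = f y" "x \<noteq> y"
    have fx: "x \<in> f x" "y \<in> f x" "bounded (f x)" "diameter (f x) \<le> \<delta>"
      using xy f[of x] f[of y] \<V> by (auto simp: covers_def)
    have "dist x y \<le> diameter (f x)"
      using fx by (intro diameter_bounded_bound)
    also have "\<dots> \<le> \<delta>" by fact
    finally show False
      using sep[OF xy(1,2,4)] by simp
  qed
  then have "card P \<le> card \<V>"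
    using \<V> f by (intro card_inj_on_le[of f]) (auto simp: covers_def)
  with \<V> show ?thesis by simp
qed

lemma covering_number_refine:
  fixes E :: "'a::metric_space set"
  assumes "covers \<delta> E \<U>"
    and refine: "\<And>U :: 'a set. bounded U \<Longrightarrow> diameter U \<le> \<delta> \<Longrightarrow> \<exists>\<W>. covers \<delta>' U \<W> \<and> card \<W> \<le> m"
  shows "covering_number \<delta>' E \<le> m * covering_number \<delta> E"
proof -
  obtain \<V> where \<V>: "covers \<delta> E \<V>" "card \<V> = covering_number \<delta> E"
    using covering_number_attained assms(1) by blast
  have "\<forall>U\<in>\<V>. \<exists>\<W>. covers \<delta>' U \<W> \<and> card \<W> \<le> m"
  proof
    fix U assume "U \<in> \<V>"
    then have "bounded U" "diameter U \<le> \<delta>"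
      using \<V> by (auto simp: covers_def)
    then show "\<exists>\<W>. covers \<delta>' U \<W> \<and> card \<W> \<le> m"
      by (rule refine)
  qed
  then obtain g where g: "\<And>U. U \<in> \<V> \<Longrightarrow> covers \<delta>' U (g U) \<and> card (g U) \<le> m"
    by metis
  have "covers \<delta>' E (\<Union>U\<in>\<V>. g U)"
    unfolding covers_def
  proof (intro conjI ballI)
    show "finite (\<Union>U\<in>\<V>. g U)"
      using g \<V> by (auto simp: covers_def)
    show "E \<subseteq> \<Union> (\<Union>U\<in>\<V>. g U)"
    proof
      fix x assume "x \<in> E"
      then obtain U where "U \<in> \<V>" "x \<in> U"
        using \<V>(1) by (auto simp: covers_def)
      moreover from this obtain W where "W \<in> g U" "x \<in> W"
        using g by (force simp: covers_def)
      ultimately show "x \<in> \<Union> (\<Union>U\<in>\<V>. g U)" by auto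
    qed
  qed (use g in \<open>auto simp: covers_def\<close>)
  then have "covering_number \<delta>' E \<le> card (\<Union>U\<in>\<V>. g U)"
    by (rule covering_number_le)
  also have "\<dots> \<le> (\<Sum>U\<in>\<V>. card (g U))"
    using \<V> by (intro card_UN_le) (auto simp: covers_def)
  also have "\<dots> \<le> (\<Sum>U\<in>\<V>. m)"
    using g by (intro sum_mono) auto
  finally show ?thesis
    using \<V> by (simp add: mult.commute)
qed

lemma covering_number_pos:
  assumes "covers \<delta> E \<U>" "E \<noteq> {}"
  shows "1 \<le> covering_number \<delta> E"
proof -
  obtain x where "x \<in> E" using assms(2) by auto
  then have "card {x} \<le> covering_number \<delta> E"
    by (intro card_separated_le_covering_number[OF assms(1)]) auto
  then show ?thesis by simp
qed

section \<open>Coverings by small cubes\<close>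

lemma card_vec_components:
  fixes P :: "'n::finite \<Rightarrow> 'a set"
  assumes "\<And>i. finite (P i)"
  shows "finite {v :: 'a ^ 'n. \<forall>i. v $ i \<in> P i}"
    and "card {v :: 'a ^ 'n. \<forall>i. v $ i \<in> P i} = (\<Prod>i\<in>UNIV. card (P i))"
proof -
  have eq: "{v :: 'a ^ 'n. \<forall>i. v $ i \<in> P i} = vec_lambda ` PiE UNIV P"
  proof (intro equalityI subsetI)
    fix v :: "'a ^ 'n" assume "v \<in> {v. \<forall>i. v $ i \<in> P i}"
    then have "vec_nth v \<in> PiE UNIV P" "v = vec_lambda (vec_nth v)"
      by auto
    then show "v \<in> vec_lambda ` PiE UNIV P" by blast
  qed auto
  have inj: "inj_on vec_lambda (PiE UNIV P)"
    by (metis inj_onI vec_lambda_inject UNIV_I)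
  show "finite {v :: 'a ^ 'n. \<forall>i. v $ i \<in> P i}"
    unfolding eq using assms by (intro finite_imageI finite_PiE) auto
  show "card {v :: 'a ^ 'n. \<forall>i. v $ i \<in> P i} = (\<Prod>i\<in>UNIV. card (P i))"
    unfolding eq card_image[OF inj] by (simp add: card_PiE)
qed

lemma cube_bounded_diameter:
  fixes a :: "real ^ 'n"
  assumes "0 \<le> s"
  defines "Q \<equiv> {x :: real ^ 'n. \<forall>i. a $ i \<le> x $ i \<and> x $ i \<le> a $ i + s}"
  shows "bounded Q" "diameter Q \<le> real CARD('n) * s"
proof -
  have *: "dist x y \<le> real CARD('n) * s" if "x \<in> Q" "y \<in> Q" for x y
  proof -
    have "dist x y \<le> (\<Sum>i\<in>UNIV. \<bar>(x - y) $ i\<bar>)"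
      unfolding dist_norm by (rule norm_le_l1_cart)
    also have "\<dots> \<le> (\<Sum>i\<in>(UNIV::'n set). s)"
    proof (rule sum_mono)
      fix i
      have "a $ i \<le> x $ i" "x $ i \<le> a $ i + s" "a $ i \<le> y $ i" "y $ i \<le> a $ i + s"
        using that by (auto simp: Q_def)
      then show "\<bar>(x - y) $ i\<bar> \<le> s" by (simp add: abs_le_iff)
    qed
    finally show ?thesis by simp
  qed
  show "bounded Q"
    unfolding bounded_two_points using * by blast
  show "diameter Q \<le> real CARD('n) * s"
    using * assms(1) by (intro diameter_le) (auto simp: dist_norm)
qed

text \<open>
  The admissible left endpoints may vary with the coordinate.  This lets the same statement serve
  for the subdivision of an arbitrarily placed cube and for coverings of a product of
  one-dimensional sets.
\<close>

lemma covers_by_cubes: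
  fixes E :: "(real ^ 'n) set"
  assumes fin: "\<And>i. finite (P i)" and "0 \<le> s" "real CARD('n) * s \<le> \<delta>"
    and E: "\<And>x i. x \<in> E \<Longrightarrow> \<exists>a\<in>P i. a \<le> x $ i \<and> x $ i \<le> a + s"
  shows "\<exists>\<U>. covers \<delta> E \<U> \<and> card \<U> \<le> (\<Prod>i\<in>UNIV. card (P i))"
proof -
  define cube where "cube v = {x :: real ^ 'n. \<forall>i. v $ i \<le> x $ i \<and> x $ i \<le> v $ i + s}" for v
  define V where "V = {v :: real ^ 'n. \<forall>i. v $ i \<in> P i}"
  have V: "finite V" "card V = (\<Prod>i\<in>UNIV. card (P i))"
    unfolding V_def by (rule card_vec_components[of P, OF fin])+
  have "covers \<delta> E (cube ` V)"
    unfolding covers_def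
  proof (intro conjI)
    show "finite (cube ` V)" using V by simp
    show "E \<subseteq> \<Union> (cube ` V)"
    proof
      fix x assume "x \<in> E"
      then obtain f where f: "\<And>i. f i \<in> P i \<and> f i \<le> x $ i \<and> x $ i \<le> f i + s"
        using E by metis
      then have "x \<in> cube (vec_lambda f)" "vec_lambda f \<in> V"
        by (auto simp: cube_def V_def)
      then show "x \<in> \<Union> (cube ` V)" by blast
    qed
    show "\<forall>U\<in>cube ` V. bounded U \<and> diameter U \<le> \<delta>"
    proof
      fix U assume "U \<in> cube ` V"
      then obtain v where "U = cube v" by blast
      then show "bounded U \<and> diameter U \<le> \<delta>"
        using cube_bounded_diameter[OF assms(2), of v] assms(3) by (simp add: cube_def)
    qed
  qed
  moreover have "card (cube ` V) \<le> (\<Prod>i\<in>UNIV. card (P i))"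
    using card_image_le[OF V(1), of cube] V(2) by simp
  ultimately show ?thesis by blast
qed

lemma cube_subdivision:
  fixes a :: "real ^ 'n"
  assumes "0 < s" "0 < m" "real CARD('n) * (s / real m) \<le> \<delta>"
    and E: "\<And>x i. x \<in> E \<Longrightarrow> a $ i \<le> x $ i \<and> x $ i \<le> a $ i + s"
  shows "\<exists>\<U>. covers \<delta> E \<U> \<and> card \<U> \<le> m ^ CARD('n)"
proof -
  define P where "P i = (\<lambda>j. a $ i + real j * (s / real m)) ` {..<m}" for i
  have "\<exists>\<U>. covers \<delta> E \<U> \<and> card \<U> \<le> (\<Prod>i\<in>UNIV. card (P i))"
  proof (rule covers_by_cubes)
    show "finite (P i)" for i by (simp add: P_def)
    show "0 \<le> s / real m" "real CARD('n) * (s / real m) \<le> \<delta>" using assms by auto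
    fix x i assume "x \<in> E"
    define u where "u = (x $ i - a $ i) / (s / real m)"
    have u: "0 \<le> u" "u \<le> real m" "x $ i = a $ i + u * (s / real m)"
      using E[OF \<open>x \<in> E\<close>, of i] assms(1,2)
        mult_left_mono[of "x $ i" "a $ i + s" "real m"] by (auto simp: u_def field_simps)
    (* The right endpoint of the interval belongs to the last of its m subintervals. *)
    define j where "j = min (nat \<lfloor>u\<rfloor>) (m - 1)"
    have j: "j < m" "real j \<le> u" "u \<le> real j + 1"
      using u assms(2) by (auto simp: j_def min_def) linarith+
    have "a $ i + real j * (s / real m) \<in> P i" using j by (auto simp: P_def)
    moreover have "a $ i + real j * (s / real m) \<le> x $ i"
      unfolding u(3) using j assms(1,2) by (intro add_left_mono mult_right_mono) auto
    moreover have "x $ i \<le> a $ i + real j * (s / real m) + s / real m"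
    proof -
      have "u * (s / real m) \<le> (real j + 1) * (s / real m)"
        using j assms(1,2) by (intro mult_right_mono) auto
      then show ?thesis unfolding u(3) by (simp only: distrib_right)
    qed
    ultimately show "\<exists>b\<in>P i. b \<le> x $ i \<and> x $ i \<le> b + s / real m" by blast
  qed
  moreover have "(\<Prod>i\<in>UNIV. card (P i)) \<le> m ^ CARD('n)"
  proof -
    have "card (P i) \<le> m" for i
      unfolding P_def using card_image_le[of "{..<m}"] by fastforce
    then have "(\<Prod>i\<in>UNIV. card (P i)) \<le> (\<Prod>i\<in>(UNIV::'n set). m)"
      by (intro prod_mono) auto
    then show ?thesis by simp
  qed
  ultimately show ?thesis
    by (blast intro: order_trans)
qed

abbreviation (input) unit_cube :: "(real ^ 'n) set" where
  "unit_cube \<equiv> {x. \<forall>i. 0 \<le> x $ i \<and> x $ i \<le> 1}"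

lemma unit_cube_covers:
  fixes C :: "(real ^ 'n) set"
  assumes "C \<subseteq> unit_cube" "0 < \<delta>"
  obtains \<U> where "covers \<delta> C \<U>"
proof -
  define m where "m = nat \<lceil>real CARD('n) / \<delta>\<rceil>"
  have m: "real CARD('n) / \<delta> \<le> real m" "0 < real CARD('n) / \<delta>"
    using assms(2) by (simp_all add: m_def)
  then have "0 < m" by linarith
  have "\<exists>\<U>. covers \<delta> C \<U> \<and> card \<U> \<le> m ^ CARD('n)"
    using assms m \<open>0 < m\<close>
    by (intro cube_subdivision[where s=1 and a=0]) (auto simp: field_simps)
  then show ?thesis using that by blast
qed

text \<open>
  A non-empty set of diameter at most \<open>\<delta>\<close> lies in a cube of side \<open>2\<delta>\<close> centred at any of its points,
  and this cube splits into small cubes of diameter at most \<open>\<delta>'\<close>.  About \<open>2 d \<delta> / \<delta>'\<close> pieces per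
  coordinate are enough; the factor \<open>3\<close> absorbs the rounding to an integer.
\<close>

lemma covering_number_growth:
  fixes C :: "(real ^ 'n) set"
  assumes C: "C \<subseteq> unit_cube" and "0 < \<delta>'" "\<delta>' \<le> \<delta>"
  shows "real (covering_number \<delta>' C)
    \<le> (3 * real CARD('n) * (\<delta> / \<delta>')) ^ CARD('n) * real (covering_number \<delta> C)"
proof -
  have "0 < \<delta>" using assms by simp
  define r where "r = 2 * real CARD('n) * (\<delta> / \<delta>')"
  define m where "m = nat \<lceil>r\<rceil>"
  have d: "1 \<le> real CARD('n)" by (simp add: Suc_le_eq)
  have q: "1 \<le> \<delta> / \<delta>'" using assms by simp
  define z where "z = real CARD('n) * (\<delta> / \<delta>')"
  have "1 * 1 \<le> z" unfolding z_def using d q by (intro mult_mono) auto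
  moreover have rz: "r = 2 * z" "3 * real CARD('n) * (\<delta> / \<delta>') = 3 * z"
    by (simp_all only: r_def z_def mult.assoc)
  ultimately have r: "2 \<le> r" "r + 1 \<le> 3 * real CARD('n) * (\<delta> / \<delta>')"
    unfolding rz by linarith+
  have "r \<le> real m" "real m \<le> r + 1" "0 < m"
    unfolding m_def using r(1) by linarith+
  then have m: "r \<le> real m" "real m \<le> 3 * real CARD('n) * (\<delta> / \<delta>')" "0 < m"
    using r(2) by linarith+
  obtain \<U> where \<U>: "covers \<delta> C \<U>"
    using unit_cube_covers C \<open>0 < \<delta>\<close> by blast
  have "covering_number \<delta>' C \<le> m ^ CARD('n) * covering_number \<delta> C"
  proof (rule covering_number_refine[OF \<U>])
    fix U :: "(real ^ 'n) set" assume U: "bounded U" "diameter U \<le> \<delta>"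
    show "\<exists>\<W>. covers \<delta>' U \<W> \<and> card \<W> \<le> m ^ CARD('n)"
    proof (cases "U = {}")
      case True
      then show ?thesis by (intro exI[of _ "{}"]) (auto simp: covers_def)
    next
      case False
      then obtain u where u: "u \<in> U" by blast
      show ?thesis
      proof (rule cube_subdivision[where s="2 * \<delta>" and a="\<chi> i. u $ i - \<delta>"])
        show "real CARD('n) * (2 * \<delta> / real m) \<le> \<delta>'"
          using m assms(2) unfolding r_def by (simp add: field_simps)
        fix x i assume "x \<in> U"
        then have "\<bar>(x - u) $ i\<bar> \<le> \<delta>"
          using component_le_norm_cart[of "x - u" i] diameter_bounded_bound[OF U(1) \<open>x \<in> U\<close> u] U(2)
          unfolding dist_norm by linarith
        then show "(\<chi> i. u $ i - \<delta>) $ i \<le> x $ i \<and> x $ i \<le> (\<chi> i. u $ i - \<delta>) $ i + 2 * \<delta>"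
          by (simp add: abs_le_iff)
      qed (use \<open>0 < \<delta>\<close> m in auto)
    qed
  qed
  then have "real (covering_number \<delta>' C) \<le> real (m ^ CARD('n) * covering_number \<delta> C)"
    by (simp only: of_nat_le_iff)
  also have "\<dots> \<le> (3 * real CARD('n) * (\<delta> / \<delta>')) ^ CARD('n) * real (covering_number \<delta> C)"
    unfolding of_nat_mult of_nat_power using m by (intro mult_right_mono power_mono) auto
  finally show ?thesis .
qed

section \<open>Logarithmic scale\<close>

text \<open>
  With \<open>\<delta> = exp (- x)\<close> the box dimensions become the lower and upper limits of \<open>log_covering C x / x\<close>,
  and the inequality that defines the covering regularity exponent says that, at the point \<open>p x\<close>,
  the graph of \<open>log_covering C\<close> is not below the line of slope \<open>t\<close>.
\<close>

definition log_covering :: "'a::metric_space set \<Rightarrow> real \<Rightarrow> real" where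
  "log_covering C x = ln (real (covering_number (exp (- x)) C))"

text \<open>
  The exponent \<open>p\<^sub>t\<^sub>,\<^sub>\<delta>\<close> at \<open>\<delta> = exp (- x)\<close>, read off from an arbitrary function \<open>L\<close> in the place of
  \<open>log_covering C\<close>: all estimates of exponents below concern real functions only.
\<close>

definition regularity_at :: "(real \<Rightarrow> real) \<Rightarrow> real \<Rightarrow> real \<Rightarrow> real" where
  "regularity_at L t x = Sup {p \<in> {0..1}. t * (p * x) \<le> L (p * x)}"

lemma at_right_0_eq_exp_at_top: "at_right (0::real) = filtermap (\<lambda>x. exp (- x)) at_top"
proof (rule filtermap_fun_inverse[symmetric])
  show "filterlim (\<lambda>x::real. - ln x) at_top (at_right 0)"
    using ln_at_0 by (simp add: filterlim_uminus_at_top)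
  have "filterlim (\<lambda>x::real. exp (- x)) (nhds 0) at_top"
    using filterlim_compose[OF exp_at_bot filterlim_uminus_at_bot_at_top] by simp
  then show "filterlim (\<lambda>x::real. exp (- x)) (at_right 0) at_top"
    by (simp add: filterlim_at)
  show "\<forall>\<^sub>F x::real in at_right 0. exp (- (- ln x)) = x"
    by (rule eventually_at_rightI[of 0 1]) auto
qed

lemma inj_exp_uminus: "inj (\<lambda>x::real. exp (- x))"
  by (auto intro: injI)

lemma lower_box_dim_log:
  "lower_box_dim C = Liminf at_top (\<lambda>x. ereal (log_covering C x / x))"
  unfolding lower_box_dim_def at_right_0_eq_exp_at_top Liminf_filtermap_eq[OF inj_exp_uminus]
  by (simp add: log_covering_def)

lemma upper_box_dim_log:
  "upper_box_dim C = Limsup at_top (\<lambda>x. ereal (log_covering C x / x))"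
  unfolding upper_box_dim_def at_right_0_eq_exp_at_top Limsup_filtermap_eq[OF inj_exp_uminus]
  by (simp add: log_covering_def)

lemma cov_reg_exponent_log:
  assumes "\<And>\<delta>. 0 < \<delta> \<Longrightarrow> 1 \<le> covering_number \<delta> C"
  shows "cov_reg_exponent t C = Liminf at_top (\<lambda>x. ereal (regularity_at (log_covering C) t x))"
proof -
  have "cov_reg_exponent_at t (exp (- x)) C = regularity_at (log_covering C) t x" for x
  proof -
    have "exp (- x) powr (- (p * t)) \<le> real (covering_number (exp (- x) powr p) C)
        \<longleftrightarrow> t * (p * x) \<le> log_covering C (p * x)" for p
    proof -
      have "0 < real (covering_number (exp (- (p * x))) C)"
        using assms[of "exp (- (p * x))"] by simp
      then show ?thesis
        by (simp add: log_covering_def exp_powr_real ln_ge_iff mult_ac)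
    qed
    then show ?thesis
      by (simp add: cov_reg_exponent_at_def regularity_at_def)
  qed
  then show ?thesis
    unfolding cov_reg_exponent_def at_right_0_eq_exp_at_top Liminf_filtermap_eq[OF inj_exp_uminus]
    by simp
qed

lemma covering_number_unit_cube_pos:
  fixes C :: "(real ^ 'n) set"
  assumes "C \<subseteq> unit_cube" "C \<noteq> {}" "0 < \<delta>"
  shows "1 \<le> covering_number \<delta> C"
  using unit_cube_covers[OF assms(1,3)] covering_number_pos assms(2) by metis

lemma log_covering_nonneg:
  fixes C :: "(real ^ 'n) set"
  assumes "C \<subseteq> unit_cube" "C \<noteq> {}"
  shows "0 \<le> log_covering C x"
  using covering_number_unit_cube_pos[OF assms, of "exp (- x)"] by (simp add: log_covering_def)

lemma log_covering_mono:
  fixes C D :: "(real ^ 'n) set"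
  assumes "C \<subseteq> D" "D \<subseteq> unit_cube" "C \<noteq> {}" "x \<le> y"
  shows "log_covering C x \<le> log_covering D y"
proof -
  obtain \<U> where \<U>: "covers (exp (- y)) D \<U>"
    using unit_cube_covers[OF assms(2), of "exp (- y)"] by auto
  have "covering_number (exp (- x)) C \<le> covering_number (exp (- y)) D"
    using covering_number_mono[OF \<U>] assms by simp
  moreover have "1 \<le> covering_number (exp (- x)) C"
    using covering_number_unit_cube_pos[of C "exp (- x)"] assms by auto
  ultimately show ?thesis
    unfolding log_covering_def by (subst ln_le_cancel_iff) auto
qed

text \<open>
  On the logarithmic scale the covering numbers of a subset of the cube grow with slope at most the
  dimension, up to an additive constant.
\<close>

lemma log_covering_growth:
  fixes C :: "(real ^ 'n) set"
  assumes C: "C \<subseteq> unit_cube" "C \<noteq> {}" and "x \<le> y"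
  shows "log_covering C y \<le> log_covering C x + real CARD('n) * (y - x)
           + real CARD('n) * ln (3 * real CARD('n))"
proof -
  let ?d = "real CARD('n)" and ?N = "\<lambda>x. real (covering_number (exp (- x)) C)"
  have pos: "0 < ?N x" for x
    using covering_number_unit_cube_pos[OF C, of "exp (- x)"] by simp
  have d: "0 < 3 * ?d" by simp
  have e: "exp (- x) / exp (- y) = exp (y - x)" by (simp add: exp_diff[symmetric])
  have "?N y \<le> (3 * ?d * exp (y - x)) ^ CARD('n) * ?N x"
    using covering_number_growth[OF C(1), of "exp (- y)" "exp (- x)"] assms(3) by (simp add: e)
  then have "ln (?N y) \<le> ln ((3 * ?d * exp (y - x)) ^ CARD('n) * ?N x)"
    using pos by (subst ln_le_cancel_iff) auto
  also have "\<dots> = ln ((3 * ?d * exp (y - x)) ^ CARD('n)) + ln (?N x)"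
    using pos d by (intro ln_mult_pos) auto
  also have "ln ((3 * ?d * exp (y - x)) ^ CARD('n)) = ?d * ln (3 * ?d * exp (y - x))"
    by (rule ln_realpow)
  also have "ln (3 * ?d * exp (y - x)) = ln (3 * ?d) + (y - x)"
    using ln_mult_pos[OF d, of "exp (y - x)"] by simp
  finally show ?thesis
    by (simp add: log_covering_def algebra_simps)
qed

section \<open>Limits inferior and superior of real functions\<close>

lemma Liminf_ereal_le:
  assumes "\<And>\<epsilon>. 0 < \<epsilon> \<Longrightarrow> \<exists>\<^sub>F x in F. f x \<le> c + \<epsilon>"
  shows "Liminf F (\<lambda>x. ereal (f x)) \<le> ereal c"
proof (rule ccontr)
  assume "\<not> ?thesis"
  then have "ereal c < Liminf F (\<lambda>x. ereal (f x))" by simp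
  from ereal_dense2[OF this]
  obtain y where y: "ereal c < ereal y" "ereal y < Liminf F (\<lambda>x. ereal (f x))" by blast
  have "\<forall>\<^sub>F x in F. \<not> f x \<le> c + (y - c)"
    using less_LiminfD[OF y(2)] by eventually_elim simp
  then show False
    using assms[of "y - c"] y(1) by (simp add: frequently_def)
qed

lemma Liminf_ereal_ge:
  assumes "\<And>\<epsilon>. 0 < \<epsilon> \<Longrightarrow> \<forall>\<^sub>F x in F. c - \<epsilon> \<le> f x"
  shows "ereal c \<le> Liminf F (\<lambda>x. ereal (f x))"
proof (rule ccontr)
  assume "\<not> ?thesis"
  then have "Liminf F (\<lambda>x. ereal (f x)) < ereal c" by simp
  from ereal_dense2[OF this]
  obtain y where y: "Liminf F (\<lambda>x. ereal (f x)) < ereal y" "ereal y < ereal c" by blast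
  have "\<forall>\<^sub>F x in F. ereal y \<le> ereal (f x)"
    using assms[of "c - y"] y(2) by simp
  then have "ereal y \<le> Liminf F (\<lambda>x. ereal (f x))"
    by (rule Liminf_bounded)
  with y(1) show False by simp
qed

lemma Limsup_ereal_le:
  assumes "\<And>\<epsilon>. 0 < \<epsilon> \<Longrightarrow> \<forall>\<^sub>F x in F. f x \<le> c + \<epsilon>"
  shows "Limsup F (\<lambda>x. ereal (f x)) \<le> ereal c"
proof -
  have "ereal (- c) \<le> Liminf F (\<lambda>x. ereal (- f x))"
  proof (rule Liminf_ereal_ge)
    fix \<epsilon> :: real assume "0 < \<epsilon>"
    from assms[OF this] show "\<forall>\<^sub>F x in F. - c - \<epsilon> \<le> - f x"
      by eventually_elim simp
  qed
  then show ?thesis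
    using ereal_Liminf_uminus[of F "\<lambda>x. ereal (f x)"] ereal_minus_le_minus[of "ereal c"] by simp
qed

lemma Limsup_ereal_ge:
  assumes "\<And>\<epsilon>. 0 < \<epsilon> \<Longrightarrow> \<exists>\<^sub>F x in F. c - \<epsilon> \<le> f x"
  shows "ereal c \<le> Limsup F (\<lambda>x. ereal (f x))"
proof -
  have "Liminf F (\<lambda>x. ereal (- f x)) \<le> ereal (- c)"
  proof (rule Liminf_ereal_le)
    fix \<epsilon> :: real assume "0 < \<epsilon>"
    from assms[OF this] show "\<exists>\<^sub>F x in F. - f x \<le> - c + \<epsilon>"
      by (rule frequently_elim1) simp
  qed
  then show ?thesis
    using ereal_Liminf_uminus[of F "\<lambda>x. ereal (f x)"] ereal_minus_le_minus[of _ "ereal c"] by simp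
qed

lemma Liminf_ereal_lessD:
  assumes "Liminf F (\<lambda>x. ereal (f x)) < ereal c"
  shows "\<exists>\<^sub>F x in F. f x < c"
proof (rule ccontr)
  assume "\<not> ?thesis"
  then have "\<forall>\<^sub>F x in F. ereal c \<le> ereal (f x)"
    by (simp add: not_frequently not_less)
  then have "ereal c \<le> Liminf F (\<lambda>x. ereal (f x))"
    by (rule Liminf_bounded)
  with assms show False by simp
qed

lemma frequently_at_top_real:
  "(\<exists>\<^sub>F x :: real in at_top. P x) \<longleftrightarrow> (\<forall>r. \<exists>x>r. P x)"
  by (simp add: frequently_def eventually_at_top_dense)

section \<open>The upper bound for the regularity exponent\<close>

lemma regularity_at_le:
  assumes "0 \<le> L 0" "\<And>p. \<lbrakk>0 \<le> p; p \<le> 1; t * (p * x) \<le> L (p * x)\<rbrakk> \<Longrightarrow> p \<le> c"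
  shows "regularity_at L t x \<le> c"
  unfolding regularity_at_def
proof (rule cSup_least)
  have "0 \<in> {p \<in> {0..1}. t * (p * x) \<le> L (p * x)}" using assms(1) by simp
  then show "{p \<in> {0..1}. t * (p * x) \<le> L (p * x)} \<noteq> {}" by blast
qed (use assms(2) in auto)

lemma regularity_at_ge:
  assumes "0 \<le> p" "p \<le> 1" "t * (p * x) \<le> L (p * x)"
  shows "p \<le> regularity_at L t x"
  unfolding regularity_at_def
proof (rule cSup_upper)
  show "bdd_above {p \<in> {0..1}. t * (p * x) \<le> L (p * x)}"
    by (rule bdd_aboveI[of _ 1]) auto
qed (use assms in auto)

text \<open>
  Let \<open>x\<close> be large with \<open>L x\<close> about \<open>b x\<close>.  After \<open>x\<close> the function \<open>L\<close> climbs with slope at most \<open>d\<close>,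
  so it needs until \<open>q x\<close>, where \<open>q = (d - b) / (d - t)\<close>, to regain the line of slope \<open>t\<close>.  Before
  \<open>x\<close> it is at most \<open>L x\<close> by monotonicity, so it is below that line on the whole of \<open>(b x / t, x)\<close>.
  Seen from \<open>q x\<close>, the last point where \<open>L\<close> is on or above the line is thus at most \<open>b x / t\<close>, and the
  ratio \<open>(b / t) / q\<close> is the bound.  A slope \<open>\<beta>\<close> slightly above \<open>b\<close> absorbs the additive constant.
\<close>

lemma regularity_upper_bound:
  fixes L :: "real \<Rightarrow> real"
  assumes mono: "\<And>x y. x \<le> y \<Longrightarrow> L x \<le> L y"
    and growth: "\<And>x y. x \<le> y \<Longrightarrow> L y \<le> L x + d * (y - x) + c"
    and "0 \<le> L 0"
    and low: "\<And>\<epsilon>. 0 < \<epsilon> \<Longrightarrow> \<exists>\<^sub>F x in at_top. L x < (b + \<epsilon>) * x"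
    and b: "0 \<le> b" "b < t" "t < d"
  shows "Liminf at_top (\<lambda>x. ereal (regularity_at L t x)) \<le> ereal (b / t * ((d - t) / (d - b)))"
proof (rule Liminf_ereal_le)
  fix \<epsilon> :: real assume "0 < \<epsilon>"
  define h where "h \<beta> = \<beta> / t * ((d - t) / (d - \<beta>))" for \<beta>
  have "(h \<longlongrightarrow> h b) (at_right b)"
    unfolding h_def using b by (intro tendsto_intros) auto
  then have "\<forall>\<^sub>F \<beta> in at_right b. h \<beta> < h b + \<epsilon>"
    using \<open>0 < \<epsilon>\<close> by (intro order_tendstoD) auto
  moreover have "\<forall>\<^sub>F \<beta> in at_right b. \<beta> < t"
    using b by (intro eventually_at_right_real[THEN eventually_mono]) auto
  moreover have "\<forall>\<^sub>F \<beta> in at_right b. b < \<beta>"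
    by (rule eventually_at_right_less)
  ultimately have "\<forall>\<^sub>F \<beta> in at_right b. h \<beta> < h b + \<epsilon> \<and> \<beta> < t \<and> b < \<beta>"
    by eventually_elim simp
  then obtain \<beta> where \<beta>: "h \<beta> < h b + \<epsilon>" "\<beta> < t" "b < \<beta>"
    using eventually_happens'[OF trivial_limit_at_right_real] by blast
  define q where "q = (d - \<beta>) / (d - t)"
  have q: "1 < q" using \<beta> b by (simp add: q_def)
  show "\<exists>\<^sub>F x in at_top. regularity_at L t x \<le> b / t * ((d - t) / (d - b)) + \<epsilon>"
    unfolding frequently_at_top_real
  proof
    fix r :: real
    have "\<exists>\<^sub>F x in at_top. L x < (b + (\<beta> - b) / 2) * x"
      using \<beta> by (intro low) simp
    then obtain x where x: "max 1 (max r (2 * c / (\<beta> - b))) < x" "L x < (b + (\<beta> - b) / 2) * x"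
      unfolding frequently_at_top_real by blast
    then have x1: "1 < x" "r < x" and "2 * c / (\<beta> - b) < x" by auto
    then have "2 * c < x * (\<beta> - b)"
      using \<beta> by (simp add: divide_less_eq)
    then have xc: "L x + c < \<beta> * x" using x(2) by (simp add: field_simps)
    have xb: "L x < \<beta> * x"
    proof -
      have "(b + (\<beta> - b) / 2) * x \<le> \<beta> * x"
        using \<beta> x1 by (intro mult_right_mono) (auto simp: field_simps)
      with x(2) show ?thesis by simp
    qed
    have "x < q * x" using q x1 by simp
    then have "r < q * x" using x1 by linarith
    moreover have "regularity_at L t (q * x) \<le> h \<beta>"
    proof (rule regularity_at_le)
      fix p :: real assume p: "0 \<le> p" "p \<le> 1" "t * (p * (q * x)) \<le> L (p * (q * x))"
      define y where "y = p * (q * x)"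
      have yq: "y \<le> q * x"
        using p q x1 mult_right_mono[of p 1 "q * x"] by (simp add: y_def)
      have "y < x"
      proof (rule ccontr)
        assume "\<not> y < x"
        then have "t * y \<le> L x + d * (y - x) + c"
          using p(3) growth[of x y] by (simp add: y_def)
        then have "t * y < \<beta> * x + d * (y - x)"
          using xc by simp
        then have "(d - \<beta>) * x < (d - t) * y" by (simp add: algebra_simps)
        also have "\<dots> \<le> (d - t) * (q * x)"
          using b yq by (intro mult_left_mono) auto
        also have "\<dots> = (d - \<beta>) * x"
          using b by (simp add: q_def)
        finally show False by simp
      qed
      then have "t * y \<le> L x"
        using p(3) mono[of y x] by (simp add: y_def)
      then have "p * (t * (q * x)) \<le> \<beta> * x"
        using xb by (simp add: y_def mult_ac)
      then have "(p * (t * q)) * x \<le> \<beta> * x" by (simp add: mult_ac)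
      then have "p * (t * q) \<le> \<beta>" using x1 by simp
      then have "p \<le> \<beta> / (t * q)"
        using b q by (subst pos_le_divide_eq) auto
      also have "\<dots> = h \<beta>" by (simp add: h_def q_def)
      finally show "p \<le> h \<beta>" .
    qed fact
    ultimately show "\<exists>z>r. regularity_at L t z \<le> b / t * ((d - t) / (d - b)) + \<epsilon>"
      using \<beta>(1) by (intro exI[of _ "q * x"]) (simp add: h_def)
  qed
qed

section \<open>Sets with prescribed covering numbers\<close>

text \<open>
  Numerators of the left endpoints of the dyadic intervals of level \<open>k\<close> that meet the set: the
  binary digit with weight \<open>1 / 2 ^ (k + 1)\<close> is free if \<open>e k\<close> holds, and zero otherwise.
\<close>

primrec dyadic :: "(nat \<Rightarrow> bool) \<Rightarrow> nat \<Rightarrow> nat set" where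
  "dyadic e 0 = {0}"
| "dyadic e (Suc k) = (\<lambda>i. 2 * i) ` dyadic e k \<union> (if e k then (\<lambda>i. 2 * i + 1) ` dyadic e k else {})"

definition digit_set :: "(nat \<Rightarrow> bool) \<Rightarrow> real set" where
  "digit_set e = {z. \<forall>k. \<exists>i\<in>dyadic e k. real i / 2 ^ k \<le> z \<and> z \<le> real i / 2 ^ k + 1 / 2 ^ k}"

lemma finite_dyadic: "finite (dyadic e k)"
  by (induction k) auto

lemma card_dyadic: "card (dyadic e k) = 2 ^ card {j. j < k \<and> e j}"
proof (induction k)
  case (Suc k)
  have inj: "inj_on (\<lambda>i. 2 * i) (dyadic e k)" "inj_on (\<lambda>i. 2 * i + 1) (dyadic e k)"
    by (auto intro: inj_onI)
  have disj: "(\<lambda>i. 2 * i) ` dyadic e k \<inter> (\<lambda>i. 2 * i + 1) ` dyadic e k = {}"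
    by (auto, presburger)
  show ?case
  proof (cases "e k")
    case True
    have "{j. j < Suc k \<and> e j} = insert k {j. j < k \<and> e j}"
      using True by (auto simp: less_Suc_eq)
    moreover have "card (dyadic e (Suc k)) = card (dyadic e k) + card (dyadic e k)"
      using True disj by (simp add: card_Un_disjoint finite_dyadic card_image[OF inj(1)]
          card_image[OF inj(2), simplified])
    ultimately show ?thesis using Suc by simp
  next
    case False
    then have "{j. j < Suc k \<and> e j} = {j. j < k \<and> e j}"
      by (auto simp: less_Suc_eq)
    then show ?thesis using False Suc by (simp add: card_image[OF inj(1)])
  qed
qed simp

lemma dyadic_mult_power: "i \<in> dyadic e k \<Longrightarrow> i * 2 ^ j \<in> dyadic e (k + j)"
  by (induction j) (auto simp: mult_ac image_iff)

lemma dyadic_div_power: "i \<in> dyadic e (k + j) \<Longrightarrow> i div 2 ^ j \<in> dyadic e k"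
proof (induction j arbitrary: i)
  case (Suc j)
  then have "i div 2 \<in> dyadic e (k + j)"
    by (auto split: if_splits)
  then have "i div 2 div 2 ^ j \<in> dyadic e k"
    by (rule Suc.IH)
  then show ?case by (simp add: div_mult2_eq)
qed simp

text \<open>
  Appending zeros to a finite sequence of admissible digits, and deleting its last digits, gives
  admissible sequences again; hence every left endpoint survives at all levels.
\<close>

lemma dyadic_point_in_digit_set:
  assumes "i \<in> dyadic e k"
  shows "real i / 2 ^ k \<in> digit_set e"
  unfolding digit_set_def
proof (intro CollectI allI)
  fix m
  show "\<exists>i'\<in>dyadic e m. real i' / 2 ^ m \<le> real i / 2 ^ k \<and> real i / 2 ^ k \<le> real i' / 2 ^ m + 1 / 2 ^ m"
  proof (cases "m \<le> k")
    case True
    then obtain j where j: "k = m + j" using le_Suc_ex by blast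
    define q where "q = i div 2 ^ j"
    have "q * 2 ^ j \<le> i" "i < (q + 1) * 2 ^ j"
      unfolding q_def using dividend_less_div_times[of "2 ^ j" i] by (auto simp: algebra_simps)
    then have "real (q * 2 ^ j) \<le> real i" "real i \<le> real ((q + 1) * 2 ^ j)"
      by (simp_all only: of_nat_le_iff)
    then have "real q / 2 ^ m \<le> real i / 2 ^ k" "real i / 2 ^ k \<le> real q / 2 ^ m + 1 / 2 ^ m"
      by (simp_all add: j power_add field_simps)
    moreover have "q \<in> dyadic e m"
      using dyadic_div_power assms by (simp add: q_def j)
    ultimately show ?thesis by blast
  next
    case False
    then obtain j where j: "m = k + j" using le_Suc_ex nat_le_linear by blast
    have "real (i * 2 ^ j) / 2 ^ m = real i / 2 ^ k"
      by (simp add: j power_add)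
    then show ?thesis
      using dyadic_mult_power[OF assms, of j] j by (intro bexI[of _ "i * 2 ^ j"]) auto
  qed
qed

lemma closed_digit_set: "closed (digit_set e)"
proof -
  have "digit_set e = (\<Inter>k. \<Union>i\<in>dyadic e k. {real i / 2 ^ k .. real i / 2 ^ k + 1 / 2 ^ k})"
    by (auto simp: digit_set_def)
  then show ?thesis
    by (simp only:) (intro closed_INT closed_UN finite_dyadic ballI closed_atLeastAtMost)
qed

lemma digit_set_unit_interval: "z \<in> digit_set e \<Longrightarrow> 0 \<le> z \<and> z \<le> 1"
  by (auto simp: digit_set_def dest: spec[of _ 0])

text \<open>
  All coordinates use the same digits, so each free digit multiplies the number of cubes by \<open>2 ^ d\<close>
  and each forced digit leaves it unchanged.  On the logarithmic scale these are the extreme slopes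
  \<open>d\<close> and \<open>0\<close>, and mixing them produces every slope in between.
\<close>

definition digit_cube :: "(nat \<Rightarrow> bool) \<Rightarrow> (real ^ 'n) set" where
  "digit_cube e = {x. \<forall>i. x $ i \<in> digit_set e}"

lemma digit_cube_subset: "digit_cube e \<subseteq> unit_cube"
  using digit_set_unit_interval by (auto simp: digit_cube_def)

lemma compact_digit_cube: "compact (digit_cube e :: (real ^ 'n) set)"
proof -
  have eq: "digit_cube e = (\<Inter>i. (\<lambda>x :: real ^ 'n. x $ i) -` digit_set e)"
    by (auto simp: digit_cube_def)
  have "closed (digit_cube e :: (real ^ 'n) set)"
    unfolding eq
    by (intro closed_INT ballI closed_vimage closed_digit_set continuous_intros)
  moreover have "bounded (unit_cube :: (real ^ 'n) set)"
    using cube_bounded_diameter(1)[of 1 "0 :: real ^ 'n"] by simp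
  then have "bounded (digit_cube e :: (real ^ 'n) set)"
    by (rule bounded_subset) (rule digit_cube_subset)
  ultimately show ?thesis
    by (simp add: compact_eq_bounded_closed)
qed

lemma digit_cube_nonempty: "(digit_cube e :: (real ^ 'n) set) \<noteq> {}"
proof -
  have "real 0 / 2 ^ 0 \<in> digit_set e"
    by (rule dyadic_point_in_digit_set) simp
  then have "(0 :: real ^ 'n) \<in> digit_cube e" by (simp add: digit_cube_def)
  then show ?thesis by blast
qed

lemma covering_number_digit_cube_le:
  assumes "real CARD('n) / 2 ^ k \<le> \<delta>"
  shows "covering_number \<delta> (digit_cube e :: (real ^ 'n) set)
      \<le> 2 ^ (CARD('n) * card {j. j < k \<and> e j})"
proof -
  define P where "P = (\<lambda>i. real i / 2 ^ k) ` dyadic e k"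
  have "\<exists>\<U>. covers \<delta> (digit_cube e :: (real ^ 'n) set) \<U> \<and> card \<U> \<le> (\<Prod>i\<in>(UNIV :: 'n set). card P)"
    by (rule covers_by_cubes[where s="1 / 2 ^ k"])
      (use assms in \<open>auto simp: P_def finite_dyadic digit_cube_def digit_set_def\<close>)
  then obtain \<U> where \<U>: "covers \<delta> (digit_cube e :: (real ^ 'n) set) \<U>" "card \<U> \<le> card P ^ CARD('n)"
    by auto
  have "card P \<le> 2 ^ card {j. j < k \<and> e j}"
    unfolding P_def card_dyadic[symmetric] by (intro card_image_le finite_dyadic)
  then have "card P ^ CARD('n) \<le> (2 ^ card {j. j < k \<and> e j}) ^ CARD('n)"
    by (rule power_mono) simp
  also have "\<dots> = 2 ^ (CARD('n) * card {j. j < k \<and> e j})"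
    by (simp add: power_mult[symmetric] mult.commute)
  finally show ?thesis
    using covering_number_le[OF \<U>(1)] \<U>(2) by linarith
qed

text \<open>
  Distinct points whose coordinates are dyadic of level \<open>k\<close> are at least \<open>1 / 2 ^ k\<close> apart.
\<close>

lemma covering_number_digit_cube_ge:
  assumes "0 < \<delta>" "\<delta> < 1 / 2 ^ k"
  shows "2 ^ (CARD('n) * card {j. j < k \<and> e j})
      \<le> covering_number \<delta> (digit_cube e :: (real ^ 'n) set)"
proof -
  define P where "P = (\<lambda>i. real i / 2 ^ k) ` dyadic e k"
  have "inj_on (\<lambda>i. real i / 2 ^ k) (dyadic e k)"
    by (auto intro: inj_onI)
  then have cP: "card P = 2 ^ card {j. j < k \<and> e j}"
    by (simp add: P_def card_image card_dyadic)
  define V where "V = {v :: real ^ 'n. \<forall>i. v $ i \<in> P}"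
  have "card V = (\<Prod>i\<in>(UNIV :: 'n set). card P)"
    unfolding V_def by (rule card_vec_components(2)) (simp add: P_def finite_dyadic)
  then have cV: "card V = 2 ^ (CARD('n) * card {j. j < k \<and> e j})"
    by (simp add: cP power_mult[symmetric] mult.commute)
  obtain \<U> where \<U>: "covers \<delta> (digit_cube e :: (real ^ 'n) set) \<U>"
    using unit_cube_covers[OF digit_cube_subset assms(1)] by blast
  have "card V \<le> covering_number \<delta> (digit_cube e :: (real ^ 'n) set)"
  proof (rule card_separated_le_covering_number[OF \<U>])
    have "P \<subseteq> digit_set e"
      using dyadic_point_in_digit_set by (auto simp: P_def)
    then show "V \<subseteq> digit_cube e"
      by (auto simp: V_def digit_cube_def)
    fix x y assume xy: "x \<in> V" "y \<in> V" "x \<noteq> y"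
    then obtain i where i: "x $ i \<noteq> y $ i" by (auto simp: vec_eq_iff)
    have "x $ i \<in> P" "y $ i \<in> P" using xy by (auto simp: V_def)
    then obtain a b where ab: "x $ i = real a / 2 ^ k" "y $ i = real b / 2 ^ k"
      by (auto simp: P_def)
    then have "a \<noteq> b" using i by auto
    then have "1 \<le> \<bar>real a - real b\<bar>" by linarith
    then have "1 / 2 ^ k \<le> \<bar>(x - y) $ i\<bar>"
      by (simp add: ab diff_divide_distrib[symmetric] divide_right_mono)
    also have "\<dots> \<le> dist x y"
      unfolding dist_norm by (rule component_le_norm_cart)
    finally show "\<delta> < dist x y" using assms(2) by simp
  qed
  with cV show ?thesis by simp
qed

text \<open>
  A function with increments in \<open>[0, 1]\<close> has integer parts with increments \<open>0\<close> or \<open>1\<close>; the positions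
  of the increments \<open>1\<close> are the free digits.
\<close>

lemma exists_digits:
  fixes G :: "nat \<Rightarrow> real"
  assumes "G 0 = 0" "\<And>k. G k \<le> G (Suc k)" "\<And>k. G (Suc k) \<le> G k + 1"
  obtains e where "\<And>k. real (card {j. j < k \<and> e j}) \<le> G k" "\<And>k. G k < real (card {j. j < k \<and> e j}) + 1"
proof -
  define e where "e j \<longleftrightarrow> \<lfloor>G (Suc j)\<rfloor> = \<lfloor>G j\<rfloor> + 1" for j
  have step: "\<lfloor>G (Suc k)\<rfloor> = \<lfloor>G k\<rfloor> + (if e k then 1 else 0)" for k
  proof -
    have "\<lfloor>G k\<rfloor> \<le> \<lfloor>G (Suc k)\<rfloor>" "\<lfloor>G (Suc k)\<rfloor> \<le> \<lfloor>G k\<rfloor> + 1"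
      using floor_mono[OF assms(2)] floor_mono[OF assms(3)] by auto
    then show ?thesis unfolding e_def by auto
  qed
  have "int (card {j. j < k \<and> e j}) = \<lfloor>G k\<rfloor>" for k
  proof (induction k)
    case (Suc k)
    have "{j. j < Suc k \<and> e j} = (if e k then insert k {j. j < k \<and> e j} else {j. j < k \<and> e j})"
      by (auto simp: less_Suc_eq)
    then show ?case using Suc step[of k] by simp
  qed (simp add: assms(1))
  then have "real (card {j. j < k \<and> e j}) = of_int \<lfloor>G k\<rfloor>" for k
    by (metis of_int_of_nat_eq)
  then show ?thesis
    using that[of e] by simp
qed

text \<open>
  Every non-decreasing function with slope at most \<open>d\<close> is the logarithmic covering number of a
  compact subset of the cube, up to a bounded error.  The error depends on the dimension only, so
  that a function may be lowered by a constant in advance in order to make \<open>log_covering C\<close> lie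
  strictly below a given bound.
\<close>

lemma exists_set_with_profile:
  fixes F :: "real \<Rightarrow> real"
  defines "d \<equiv> real CARD('n)"
  assumes F0: "F 0 = 0" and mono: "\<And>x y. \<lbrakk>0 \<le> x; x \<le> y\<rbrakk> \<Longrightarrow> F x \<le> F y"
    and lip: "\<And>x y. \<lbrakk>0 \<le> x; x \<le> y\<rbrakk> \<Longrightarrow> F y \<le> F x + d * (y - x)"
  shows "\<exists>C :: (real ^ 'n) set. compact C \<and> C \<noteq> {} \<and> C \<subseteq> unit_cube \<and>
    (\<forall>x\<ge>0. \<bar>log_covering C x - F x\<bar> \<le> d * (ln d + 2 * ln 2))"
proof -
  have d: "1 \<le> d" by (simp add: d_def Suc_le_eq)
  have l2: "0 < ln (2::real)" by simp
  define G where "G k = F (real k * ln 2) / (d * ln 2)" for k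
  obtain e where e: "\<And>k. real (card {j. j < k \<and> e j}) \<le> G k" "\<And>k. G k < real (card {j. j < k \<and> e j}) + 1"
  proof (rule exists_digits[of G])
    show "G 0 = 0" by (simp add: G_def F0)
    fix k
    show "G k \<le> G (Suc k)"
      unfolding G_def using d l2 by (intro divide_right_mono mono) auto
    have "F (real (Suc k) * ln 2) \<le> F (real k * ln 2) + d * (real (Suc k) * ln 2 - real k * ln 2)"
      using l2 by (intro lip) auto
    also have "d * (real (Suc k) * ln 2 - real k * ln 2) = d * ln 2"
      by (simp add: algebra_simps)
    finally have "G (Suc k) \<le> (F (real k * ln 2) + d * ln 2) / (d * ln 2)"
      unfolding G_def using d l2 by (intro divide_right_mono) auto
    also have "\<dots> = G k + 1"
      using d l2 by (simp add: G_def add_divide_distrib)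
    finally show "G (Suc k) \<le> G k + 1" .
  qed (rule that)
  define S where "S k = card {j. j < k \<and> e j}" for k
  have S: "d * real (S k) * ln 2 \<le> F (real k * ln 2)"
    "F (real k * ln 2) \<le> d * real (S k) * ln 2 + d * ln 2" for k
  proof -
    have G: "G k * (d * ln 2) = F (real k * ln 2)"
      using d l2 by (simp add: G_def)
    have "real (S k) * (d * ln 2) \<le> G k * (d * ln 2)" "G k * (d * ln 2) \<le> (real (S k) + 1) * (d * ln 2)"
      using d l2 e[of k] by (intro mult_right_mono; simp add: S_def)+
    then show "d * real (S k) * ln 2 \<le> F (real k * ln 2)"
      "F (real k * ln 2) \<le> d * real (S k) * ln 2 + d * ln 2"
      unfolding G by (simp_all add: algebra_simps)
  qed
  define C where "C = (digit_cube e :: (real ^ 'n) set)"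
  have C: "compact C" "C \<noteq> {}" "C \<subseteq> unit_cube"
    unfolding C_def by (rule compact_digit_cube digit_cube_nonempty digit_cube_subset)+
  have N: "1 \<le> covering_number (exp (- x)) C" for x
    using covering_number_unit_cube_pos[OF C(3,2)] by simp
  have pow: "ln (real (2 ^ (CARD('n) * S k))) = d * real (S k) * ln 2" for k
    by (simp add: ln_realpow d_def)
  have expk: "exp (- (real k * ln 2)) = 1 / 2 ^ k" for k
    by (simp add: exp_minus exp_of_nat_mult inverse_eq_divide)
  \<comment> \<open>For the upper estimate the scale of level \<open>k\<close> is chosen just fine enough that a dyadic cube of
    side \<open>1 / 2 ^ k\<close> has diameter at most \<open>exp (- x)\<close>; for the lower one, just coarse enough that
    points of level \<open>k\<close> are more than \<open>exp (- x)\<close> apart.\<close>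
  have up: "log_covering C x \<le> F x + d * (ln d + 2 * ln 2)" if "0 \<le> x" for x
  proof -
    define k where "k = nat \<lceil>(x + ln d) / ln 2\<rceil>"
    have "0 \<le> (x + ln d) / ln 2"
      using that d by (intro divide_nonneg_nonneg add_nonneg_nonneg) auto
    then have "(x + ln d) / ln 2 \<le> real k" "real k \<le> (x + ln d) / ln 2 + 1"
      unfolding k_def by linarith+
    then have k: "x + ln d \<le> real k * ln 2" "real k * ln 2 \<le> x + ln d + ln 2"
      using l2 by (simp_all add: field_simps)
    have "d / 2 ^ k \<le> exp (- x)"
    proof -
      have "d / 2 ^ k = exp (ln d - real k * ln 2)"
        using d expk[of k] by (simp add: exp_diff exp_minus inverse_eq_divide)
      also have "\<dots> \<le> exp (- x)" using k by simp
      finally show ?thesis .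
    qed
    then have "covering_number (exp (- x)) C \<le> 2 ^ (CARD('n) * S k)"
      unfolding C_def S_def d_def by (rule covering_number_digit_cube_le)
    then have "real (covering_number (exp (- x)) C) \<le> real (2 ^ (CARD('n) * S k))"
      by (simp only: of_nat_le_iff)
    then have "log_covering C x \<le> ln (real (2 ^ (CARD('n) * S k)))"
      unfolding log_covering_def using N[of x] by (subst ln_le_cancel_iff) auto
    also have "\<dots> \<le> F (real k * ln 2)"
      unfolding pow by (rule S)
    also have "\<dots> \<le> F x + d * (real k * ln 2 - x)"
      using k d that ln_ge_zero[OF d] by (intro lip) linarith+
    also have "d * (real k * ln 2 - x) \<le> d * (ln d + 2 * ln 2)"
      using k d l2 by (intro mult_left_mono) linarith+
    finally show ?thesis by simp
  qed
  have low: "F x - d * (ln d + 2 * ln 2) \<le> log_covering C x" if "0 \<le> x" for x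
  proof (cases "x = 0")
    case True
    have "0 \<le> d * (ln d + 2 * ln 2)"
      using d l2 by (intro mult_nonneg_nonneg add_nonneg_nonneg) auto
    then show ?thesis
      using log_covering_nonneg[OF C(3,2), of x] True F0 by simp
  next
    case False
    define k where "k = nat (\<lceil>x / ln 2\<rceil> - 1)"
    have "0 < x / ln 2" using that False by simp
    then have "x / ln 2 - 1 \<le> real k" "real k < x / ln 2"
      unfolding k_def by linarith+
    then have k: "x - ln 2 \<le> real k * ln 2" "real k * ln 2 < x"
      using l2 by (simp_all add: field_simps)
    have "exp (- x) < 1 / 2 ^ k"
      unfolding expk[symmetric] using k by simp
    then have "2 ^ (CARD('n) * S k) \<le> covering_number (exp (- x)) C"
      unfolding C_def S_def by (intro covering_number_digit_cube_ge) auto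
    then have "real (2 ^ (CARD('n) * S k)) \<le> real (covering_number (exp (- x)) C)"
      by (simp only: of_nat_le_iff)
    then have "ln (real (2 ^ (CARD('n) * S k))) \<le> log_covering C x"
      unfolding log_covering_def using N[of x] by (subst ln_le_cancel_iff) auto
    then have "F (real k * ln 2) \<le> log_covering C x + d * ln 2"
      using S(2)[of k] unfolding pow by linarith
    moreover have "F x \<le> F (real k * ln 2) + d * (x - real k * ln 2)"
      using k l2 by (intro lip) auto
    moreover have "d * (x - real k * ln 2) \<le> d * ln 2"
      using k d by (intro mult_left_mono) linarith+
    moreover have "0 \<le> d * ln d" using d by simp
    ultimately show ?thesis by (simp add: distrib_left)
  qed
  have "\<bar>log_covering C x - F x\<bar> \<le> d * (ln d + 2 * ln 2)" if "0 \<le> x" for x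
    using up[OF that] low[OF that] by linarith
  with C show ?thesis by blast
qed

section \<open>Profiles pinned to a line along a set\<close>

locale pinned_profile =
  fixes b B d :: real and A :: "real set"
  assumes b_pos: "0 < b" and b_less_B: "b < B" and B_le_d: "B \<le> d"
    and A_pos: "\<And>\<kappa>. \<kappa> \<in> A \<Longrightarrow> 0 < \<kappa>" and A_nonempty: "A \<noteq> {}"
begin

text \<open>
  The largest non-decreasing function on \<open>[0, \<infinity>)\<close> with slope at most \<open>d\<close> that stays below the line of
  slope \<open>B\<close> everywhere and below the line of slope \<open>b\<close> on \<open>A\<close>.  It never drops below the line of slope
  \<open>b\<close>, and equals \<open>b \<kappa>\<close> at the points \<open>\<kappa>\<close> of \<open>A\<close>.  Before such a point it is flat, after it it climbs
  with slope \<open>d\<close>, unless the line of slope \<open>B\<close> or another point of \<open>A\<close> intervenes.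
\<close>

definition profile :: "real \<Rightarrow> real" where
  "profile x = min (B * x) (INF \<kappa>\<in>A. b * \<kappa> + d * max 0 (x - \<kappa>))"

lemma bdd_below_terms: "bdd_below ((\<lambda>\<kappa>. b * \<kappa> + d * max 0 (x - \<kappa>)) ` A)"
proof (rule bdd_belowI2)
  fix \<kappa> assume "\<kappa> \<in> A"
  then show "0 \<le> b * \<kappa> + d * max 0 (x - \<kappa>)"
    using A_pos[of \<kappa>] b_pos b_less_B B_le_d by (intro add_nonneg_nonneg mult_nonneg_nonneg) auto
qed

lemma profile_le: "\<kappa> \<in> A \<Longrightarrow> profile x \<le> b * \<kappa> + d * max 0 (x - \<kappa>)"
  unfolding profile_def by (intro min.coboundedI2 cINF_lower bdd_below_terms)

lemma profile_le_line: "profile x \<le> B * x"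
  by (simp add: profile_def)

lemma profile_ge:
  assumes "y \<le> B * x" "\<And>\<kappa>. \<kappa> \<in> A \<Longrightarrow> y \<le> b * \<kappa> + d * max 0 (x - \<kappa>)"
  shows "y \<le> profile x"
  unfolding profile_def using assms A_nonempty by (intro min.boundedI cINF_greatest) auto

lemma profile_0: "profile 0 = 0"
proof (rule antisym)
  show "0 \<le> profile 0"
    using A_pos b_pos b_less_B B_le_d
    by (intro profile_ge add_nonneg_nonneg mult_nonneg_nonneg) (auto intro: less_imp_le)
qed (use profile_le_line[of 0] in simp)

lemma profile_mono:
  assumes "x \<le> y"
  shows "profile x \<le> profile y"
proof (rule profile_ge)
  show "profile x \<le> B * y"
    using profile_le_line[of x] mult_left_mono[OF assms, of B] b_pos b_less_B by linarith
  fix \<kappa> assume "\<kappa> \<in> A"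
  have "d * max 0 (x - \<kappa>) \<le> d * max 0 (y - \<kappa>)"
    using assms b_pos b_less_B B_le_d by (intro mult_left_mono) auto
  then show "profile x \<le> b * \<kappa> + d * max 0 (y - \<kappa>)"
    using profile_le[OF \<open>\<kappa> \<in> A\<close>, of x] by simp
qed

lemma profile_lipschitz:
  assumes "x \<le> y"
  shows "profile y \<le> profile x + d * (y - x)"
proof -
  have "profile y - d * (y - x) \<le> profile x"
  proof (rule profile_ge)
    have "B * (y - x) \<le> d * (y - x)"
      using assms B_le_d by (intro mult_right_mono) auto
    then show "profile y - d * (y - x) \<le> B * x"
      using profile_le_line[of y] by (simp add: algebra_simps)
    fix \<kappa> assume "\<kappa> \<in> A"
    have "d * max 0 (y - \<kappa>) \<le> d * (max 0 (x - \<kappa>) + (y - x))"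
      using assms b_pos b_less_B B_le_d by (intro mult_left_mono) auto
    then show "profile y - d * (y - x) \<le> b * \<kappa> + d * max 0 (x - \<kappa>)"
      using profile_le[OF \<open>\<kappa> \<in> A\<close>, of y] by (simp add: distrib_left)
  qed
  then show ?thesis by simp
qed

lemma profile_ge_line:
  assumes "0 \<le> x"
  shows "b * x \<le> profile x"
proof (rule profile_ge)
  show "b * x \<le> B * x" using assms b_less_B by (intro mult_right_mono) auto
  fix \<kappa> assume "\<kappa> \<in> A"
  have "b * (x - \<kappa>) \<le> b * max 0 (x - \<kappa>)" using b_pos by (intro mult_left_mono) auto
  also have "\<dots> \<le> d * max 0 (x - \<kappa>)" using b_less_B B_le_d by (intro mult_right_mono) auto
  finally show "b * x \<le> b * \<kappa> + d * max 0 (x - \<kappa>)" by (simp add: algebra_simps)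
qed

lemma profile_le_on: "\<kappa> \<in> A \<Longrightarrow> profile \<kappa> \<le> b * \<kappa>"
  using profile_le[of \<kappa> \<kappa>] by simp

lemma liminf_near_profile:
  assumes near: "\<And>x. 0 \<le> x \<Longrightarrow> \<bar>L x - profile x\<bar> \<le> M"
    and unbounded: "\<And>r. \<exists>\<kappa>\<in>A. r < \<kappa>"
  shows "Liminf at_top (\<lambda>x. ereal (L x / x)) = ereal b"
proof (rule antisym)
  show "Liminf at_top (\<lambda>x. ereal (L x / x)) \<le> ereal b"
  proof (rule Liminf_ereal_le)
    fix \<epsilon> :: real assume "0 < \<epsilon>"
    show "\<exists>\<^sub>F x in at_top. L x / x \<le> b + \<epsilon>"
      unfolding frequently_at_top_real
    proof
      fix r
      obtain x where x: "x \<in> A" "max r (M / \<epsilon>) < x" using unbounded by blast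
      then have "0 < x" using A_pos by blast
      have "M < \<epsilon> * x" using x(2) \<open>0 < \<epsilon>\<close> by (simp add: divide_less_eq mult.commute)
      then have "L x \<le> (b + \<epsilon>) * x"
        using near[of x] profile_le_on[OF x(1)] \<open>0 < x\<close> by (simp add: algebra_simps)
      then have "L x / x \<le> b + \<epsilon>" using \<open>0 < x\<close> by (simp add: divide_le_eq)
      then show "\<exists>x>r. L x / x \<le> b + \<epsilon>" using x by auto
    qed
  qed
  show "ereal b \<le> Liminf at_top (\<lambda>x. ereal (L x / x))"
  proof (rule Liminf_ereal_ge)
    fix \<epsilon> :: real assume "0 < \<epsilon>"
    show "\<forall>\<^sub>F x in at_top. b - \<epsilon> \<le> L x / x"
      using eventually_gt_at_top[of "max 0 (M / \<epsilon>)"]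
    proof eventually_elim
      case (elim x)
      then have "M < \<epsilon> * x" using \<open>0 < \<epsilon>\<close> by (simp add: divide_less_eq mult.commute)
      then have "(b - \<epsilon>) * x \<le> L x"
        using near[of x] profile_ge_line[of x] elim by (simp add: algebra_simps)
      then show ?case using elim by (simp add: le_divide_eq)
    qed
  qed
qed

text \<open>
  In the middle of a long gap of \<open>A\<close> the points of \<open>A\<close> on the right are so far away that \<open>b \<kappa> \<ge> B x\<close>,
  and those on the left are so far away that a climb with slope \<open>d \<ge> B\<close> has all but reached the
  line of slope \<open>B\<close>.  For \<open>B = d\<close> the line is only approached, hence the \<open>\<epsilon>\<close>.
\<close>

lemma limsup_near_profile:
  assumes near: "\<And>x. 0 \<le> x \<Longrightarrow> \<bar>L x - profile x\<bar> \<le> M"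
    and gaps: "\<And>R r. 1 < R \<Longrightarrow> \<exists>x>r. \<forall>\<kappa>\<in>A. R * \<kappa> \<le> x \<or> R * x \<le> \<kappa>"
  shows "Limsup at_top (\<lambda>x. ereal (L x / x)) = ereal B"
proof (rule antisym)
  show "Limsup at_top (\<lambda>x. ereal (L x / x)) \<le> ereal B"
  proof (rule Limsup_ereal_le)
    fix \<epsilon> :: real assume "0 < \<epsilon>"
    show "\<forall>\<^sub>F x in at_top. L x / x \<le> B + \<epsilon>"
      using eventually_gt_at_top[of "max 0 (M / \<epsilon>)"]
    proof eventually_elim
      case (elim x)
      then have "M < \<epsilon> * x" using \<open>0 < \<epsilon>\<close> by (simp add: divide_less_eq mult.commute)
      then have "L x \<le> (B + \<epsilon>) * x"
        using near[of x] profile_le_line[of x] elim by (simp add: algebra_simps)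
      then show ?case using elim by (simp add: divide_le_eq)
    qed
  qed
  show "ereal B \<le> Limsup at_top (\<lambda>x. ereal (L x / x))"
  proof (rule Limsup_ereal_ge)
    fix \<epsilon> :: real assume "0 < \<epsilon>"
    show "\<exists>\<^sub>F x in at_top. B - \<epsilon> \<le> L x / x"
      unfolding frequently_at_top_real
    proof
      fix r
      define R where "R = 1 + B / b + 2 * d / \<epsilon>"
      have d: "0 < d" using b_pos b_less_B B_le_d by simp
      have "0 < B / b" "0 < 2 * d / \<epsilon>" using b_pos b_less_B d \<open>0 < \<epsilon>\<close> by auto
      then have R: "1 < R" "B / b \<le> R" "2 * d / \<epsilon> \<le> R" by (auto simp: R_def)
      then have R': "B \<le> b * R" "2 * d \<le> \<epsilon> * R"
        using b_pos \<open>0 < \<epsilon>\<close> by (simp_all add: divide_le_eq mult.commute)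
      obtain x where x: "max 0 (max r (2 * M / \<epsilon>)) < x" "\<forall>\<kappa>\<in>A. R * \<kappa> \<le> x \<or> R * x \<le> \<kappa>"
        using gaps[OF R(1)] by blast
      then have x0: "0 < x" "r < x" and "2 * M / \<epsilon> < x" by auto
      then have M: "2 * M < \<epsilon> * x"
        using \<open>0 < \<epsilon>\<close> by (simp add: divide_less_eq mult.commute)
      have "(B - \<epsilon> / 2) * x \<le> profile x"
      proof (rule profile_ge)
        show "(B - \<epsilon> / 2) * x \<le> B * x"
          using x0 \<open>0 < \<epsilon>\<close> by (intro mult_right_mono) auto
        fix \<kappa> assume \<kappa>: "\<kappa> \<in> A"
        with x(2) consider "R * \<kappa> \<le> x" | "R * x \<le> \<kappa>" by blast
        then show "(B - \<epsilon> / 2) * x \<le> b * \<kappa> + d * max 0 (x - \<kappa>)"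
        proof cases
          case 1
          have "0 < \<kappa>" using A_pos \<kappa> by blast
          have "2 * d * \<kappa> \<le> \<epsilon> * R * \<kappa>" using R'(2) \<open>0 < \<kappa>\<close> by (intro mult_right_mono) auto
          also have "\<dots> \<le> \<epsilon> * x"
            using mult_left_mono[OF 1, of \<epsilon>] \<open>0 < \<epsilon>\<close> by (simp add: mult_ac)
          finally have "2 * (d * \<kappa>) \<le> \<epsilon> * x" by simp
          moreover have "d * (x - \<kappa>) \<le> d * max 0 (x - \<kappa>)" using d by (intro mult_left_mono) auto
          moreover have "B * x \<le> d * x" using B_le_d x0 by (intro mult_right_mono) auto
          moreover have "0 \<le> b * \<kappa>" using b_pos \<open>0 < \<kappa>\<close> by simp
          ultimately show ?thesis by (simp add: algebra_simps)
        next
          case 2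
          have "B * x \<le> b * R * x" using R'(1) x0 by (intro mult_right_mono) auto
          also have "\<dots> \<le> b * \<kappa>" using mult_left_mono[OF 2, of b] b_pos by (simp add: mult_ac)
          finally have "B * x \<le> b * \<kappa>" .
          moreover have "0 \<le> d * max 0 (x - \<kappa>)" using d by (intro mult_nonneg_nonneg) auto
          moreover have "0 \<le> \<epsilon> * x" using \<open>0 < \<epsilon>\<close> x0 by simp
          ultimately show ?thesis by (simp add: algebra_simps)
        qed
      qed
      then have "(B - \<epsilon>) * x \<le> L x"
        using near[of x] x0 M by (simp add: algebra_simps)
      then have "B - \<epsilon> \<le> L x / x" using x0 by (simp add: le_divide_eq)
      then show "\<exists>x>r. B - \<epsilon> \<le> L x / x" using x0 by blast
    qed
  qed
qed

text \<open>
  Suppose that the profile is below the line of slope \<open>s\<close> at \<open>x\<close>.  Some \<open>\<kappa>' \<in> A\<close> is responsible for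
  that, and it gives two inequalities: \<open>b \<kappa>' < s x\<close>, so that the point \<open>y = b \<kappa>' / s\<close> lies to the left
  of \<open>x\<close>, and \<open>(d - s) x < (d - b) \<kappa>'\<close>, which says precisely that \<open>y / x\<close> exceeds the exponent
  claimed for \<open>s\<close>.
  At \<open>y\<close> the flat piece of height \<open>b \<kappa>'\<close> in front of \<open>\<kappa>'\<close> meets the line of slope \<open>s\<close>.  Sparseness
  ensures that the profile has reached this piece at \<open>y\<close>, as earlier points of \<open>A\<close> are negligible.
  Taking \<open>s\<close> slightly larger than \<open>t\<close> turns the bounded distance between \<open>L\<close> and the profile into
  the inequality \<open>t y \<le> L y\<close>.
\<close>

lemma regularity_lower_bound:
  assumes near: "\<And>x. 0 \<le> x \<Longrightarrow> \<bar>L x - profile x\<bar> \<le> M"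
    and sparse: "\<And>R. \<exists>r. \<forall>\<kappa>\<in>A. \<forall>\<kappa>'\<in>A. r < \<kappa>' \<and> \<kappa> < \<kappa>' \<longrightarrow> R * \<kappa> \<le> \<kappa>'"
    and t: "b < t" "t < B"
  shows "ereal (b / t * ((d - t) / (d - b))) \<le> Liminf at_top (\<lambda>x. ereal (regularity_at L t x))"
proof (rule Liminf_ereal_ge)
  fix \<epsilon> :: real assume "0 < \<epsilon>"
  define h where "h s = b / s * ((d - s) / (d - b))" for s
  have "(h \<longlongrightarrow> h t) (at_right t)"
    unfolding h_def using b_pos t B_le_d by (intro tendsto_intros) auto
  then have "\<forall>\<^sub>F s in at_right t. h t - \<epsilon> < h s"
    using \<open>0 < \<epsilon>\<close> by (intro order_tendstoD) auto
  moreover have "\<forall>\<^sub>F s in at_right t. t < s \<and> s < B"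
    using eventually_at_right_real[OF t(2)] by eventually_elim simp
  ultimately have "\<forall>\<^sub>F s in at_right t. h t - \<epsilon> < h s \<and> t < s \<and> s < B"
    by eventually_elim simp
  then obtain s where s: "h t - \<epsilon> < h s" "t < s" "s < B"
    using eventually_happens'[OF trivial_limit_at_right_real] by blast
  have bs: "b < s" "s < d" "0 < s" using s t b_pos B_le_d by auto
  define v where "v = h s"
  have v: "v * (s * (d - b)) = b * (d - s)" using bs by (simp add: v_def h_def)
  have "0 < v" using bs b_pos by (simp add: v_def h_def)
  have "b * (d - s) \<le> s * (d - b)"
    using bs b_pos mult_strict_right_mono[of b s d] by (simp add: algebra_simps)
  then have "v * (s * (d - b)) \<le> 1 * (s * (d - b))" using v by simp
  then have "v \<le> 1"
    by (rule mult_right_le_imp_le) (use bs in simp)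
  obtain r where r: "\<And>\<kappa> \<kappa>'. \<lbrakk>\<kappa> \<in> A; \<kappa>' \<in> A; r < \<kappa>'; \<kappa> < \<kappa>'\<rbrakk> \<Longrightarrow> 1 / v * \<kappa> \<le> \<kappa>'"
    using sparse[of "1 / v"] by blast
  define x0 where "x0 = max 0 (max (r * (d - b) / (d - s)) (M / (v * (s - t))))"
  show "\<forall>\<^sub>F x in at_top. b / t * ((d - t) / (d - b)) - \<epsilon> \<le> regularity_at L t x"
    using eventually_gt_at_top[of x0]
  proof eventually_elim
    case (elim x)
    then have x: "0 < x" "r * (d - b) / (d - s) < x" "M / (v * (s - t)) < x"
      by (auto simp: x0_def)
    have big: "t * y \<le> L y" if y: "v * x \<le> y" "s * y \<le> profile y" for y
    proof -
      have "M < (s - t) * (v * x)"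
        using x(3) \<open>0 < v\<close> s(2) by (simp add: divide_less_eq mult_ac)
      also have "\<dots> \<le> (s - t) * y" using y(1) s(2) by (intro mult_left_mono) auto
      finally have "M \<le> (s - t) * y" by simp
      moreover have "0 \<le> v * x" using \<open>0 < v\<close> x(1) by simp
      ultimately show ?thesis using near[of y] y by (simp add: algebra_simps)
    qed
    have "v \<le> regularity_at L t x"
    proof (cases "s * x \<le> profile x")
      case True
      have "1 \<le> regularity_at L t x"
        using big[of x] True \<open>v \<le> 1\<close> x(1) by (intro regularity_at_ge) auto
      with \<open>v \<le> 1\<close> show ?thesis by simp
    next
      case False
      moreover have "s * x \<le> B * x" using s x by (intro mult_right_mono) auto
      ultimately obtain \<kappa>' where \<kappa>': "\<kappa>' \<in> A" "b * \<kappa>' + d * max 0 (x - \<kappa>') < s * x"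
        using profile_ge[of "s * x" x] by (meson not_le)
      have "0 < \<kappa>'" using A_pos \<kappa>'(1) by blast
      define y where "y = b * \<kappa>' / s"
      have sy: "s * y = b * \<kappa>'" using bs by (simp add: y_def)
      have "0 < y" using \<open>0 < \<kappa>'\<close> b_pos bs by (simp add: y_def)
      have "0 \<le> d * max 0 (x - \<kappa>')" using bs by (intro mult_nonneg_nonneg) auto
      then have "s * y < s * x" using \<kappa>'(2) sy by simp
      then have "y < x" using bs by simp
      have "d * (x - \<kappa>') \<le> d * max 0 (x - \<kappa>')" using bs by (intro mult_left_mono) auto
      then have x\<kappa>: "x * (d - s) < \<kappa>' * (d - b)" using \<kappa>'(2) by (simp add: algebra_simps)
      have "r * (d - b) < x * (d - s)" using x(2) bs by (simp add: divide_less_eq)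
      then have "r * (d - b) < \<kappa>' * (d - b)" using x\<kappa> by simp
      then have "r < \<kappa>'" using bs by simp
      have v\<kappa>: "v * \<kappa>' * (d - b) = y * (d - s)"
      proof -
        have "s * (v * \<kappa>' * (d - b)) = (v * (s * (d - b))) * \<kappa>'" by simp
        also have "\<dots> = (s * y) * (d - s)" by (simp add: v sy)
        finally show ?thesis using bs by simp
      qed
      have "v * x \<le> y"
      proof -
        have "v * (x * (d - s)) \<le> v * (\<kappa>' * (d - b))"
          using x\<kappa> \<open>0 < v\<close> by (intro mult_left_mono) auto
        then have "(v * x) * (d - s) \<le> y * (d - s)" using v\<kappa> by (simp add: mult_ac)
        then show ?thesis using bs by simp
      qed
      have "s * y \<le> profile y"
      proof (rule profile_ge)
        show "s * y \<le> B * y" using s \<open>0 < y\<close> by (intro mult_right_mono) auto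
        fix \<kappa> assume \<kappa>: "\<kappa> \<in> A"
        show "s * y \<le> b * \<kappa> + d * max 0 (y - \<kappa>)"
        proof (cases "\<kappa>' \<le> \<kappa>")
          case True
          have "b * \<kappa>' \<le> b * \<kappa>" using True b_pos by simp
          moreover have "0 \<le> d * max 0 (y - \<kappa>)" using bs by (intro mult_nonneg_nonneg) auto
          ultimately show ?thesis using sy by simp
        next
          case False
          then have "1 / v * \<kappa> \<le> \<kappa>'" using r \<kappa> \<kappa>'(1) \<open>r < \<kappa>'\<close> by simp
          then have "\<kappa> \<le> v * \<kappa>'" using \<open>0 < v\<close> by (simp add: divide_le_eq mult.commute)
          then have "\<kappa> * (d - b) \<le> v * \<kappa>' * (d - b)" using bs by (intro mult_right_mono) auto
          then have "\<kappa> * (d - b) \<le> y * (d - s)" using v\<kappa> by simp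
          moreover have "d * (y - \<kappa>) \<le> d * max 0 (y - \<kappa>)" using bs by (intro mult_left_mono) auto
          ultimately show ?thesis by (simp add: algebra_simps)
        qed
      qed
      then have "t * y \<le> L y" using big \<open>v * x \<le> y\<close> by blast
      then have "y / x \<le> regularity_at L t x"
        using \<open>0 < y\<close> \<open>y < x\<close> by (intro regularity_at_ge) auto
      moreover have "v \<le> y / x" using \<open>v * x \<le> y\<close> x(1) by (simp add: le_divide_eq)
      ultimately show ?thesis by simp
    qed
    then show ?case using s(1) by (simp add: v_def h_def)
  qed
qed

end

text \<open>
  If \<open>L\<close> is below the line of slope \<open>b\<close> on \<open>[\<epsilon> x, x]\<close>, then the exponent at \<open>x\<close> is at most \<open>\<epsilon>\<close>.
\<close>

lemma regularity_vanishes: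
  fixes L :: "real \<Rightarrow> real"
  assumes "0 \<le> L 0"
    and below: "\<And>x. \<lbrakk>x \<in> A; M < x\<rbrakk> \<Longrightarrow> L x < b * x"
    and blocks: "\<And>\<epsilon> r. \<lbrakk>0 < \<epsilon>; \<epsilon> < 1\<rbrakk> \<Longrightarrow> \<exists>x>r. {\<epsilon> * x..x} \<subseteq> A"
    and "b \<le> t"
  shows "Liminf at_top (\<lambda>x. ereal (regularity_at L t x)) = 0"
proof (rule antisym)
  have "Liminf at_top (\<lambda>x. ereal (regularity_at L t x)) \<le> ereal 0"
  proof (rule Liminf_ereal_le)
    fix \<epsilon> :: real assume "0 < \<epsilon>"
    define \<eta> where "\<eta> = min \<epsilon> (1 / 2)"
    have \<eta>: "0 < \<eta>" "\<eta> < 1" "\<eta> \<le> \<epsilon>" using \<open>0 < \<epsilon>\<close> by (auto simp: \<eta>_def)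
    show "\<exists>\<^sub>F x in at_top. regularity_at L t x \<le> 0 + \<epsilon>"
      unfolding frequently_at_top_real
    proof
      fix r
      obtain x where x: "max r (max 0 (M / \<eta>)) < x" "{\<eta> * x..x} \<subseteq> A"
        using blocks[OF \<eta>(1,2)] by blast
      then have "0 < x" and "M / \<eta> < x" by auto
      then have M: "M < \<eta> * x" using \<eta> by (simp add: divide_less_eq mult.commute)
      have "regularity_at L t x \<le> \<eta>"
      proof (rule regularity_at_le)
        fix p :: real assume p: "0 \<le> p" "p \<le> 1" "t * (p * x) \<le> L (p * x)"
        show "p \<le> \<eta>"
        proof (rule ccontr)
          assume "\<not> p \<le> \<eta>"
          then have "\<eta> * x \<le> p * x" using \<open>0 < x\<close> by simp
          moreover have "p * x \<le> x" using p \<open>0 < x\<close> by (simp add: mult_left_le_one_le)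
          ultimately have "L (p * x) < b * (p * x)"
            using x(2) M by (intro below) auto
          also have "\<dots> \<le> t * (p * x)"
            using assms(4) p \<open>0 < x\<close> by (intro mult_right_mono) auto
          finally show False using p(3) by simp
        qed
      qed fact
      then show "\<exists>x>r. regularity_at L t x \<le> 0 + \<epsilon>" using x(1) \<eta>(3) by (intro exI[of _ x]) auto
    qed
  qed
  then show "Liminf at_top (\<lambda>x. ereal (regularity_at L t x)) \<le> 0" by (simp add: zero_ereal_def)
  have "0 \<le> regularity_at L t x" for x
    using assms(1) by (intro regularity_at_ge) auto
  then show "0 \<le> Liminf at_top (\<lambda>x. ereal (regularity_at L t x))"
    by (intro Liminf_bounded) auto
qed

text \<open>
  The profile is lowered by a constant larger than the error of the realisation.  This changes
  neither dimensions nor the lower bound for the exponents, and it makes the inequality on \<open>A\<close> strict,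
  as is necessary for the exponent to vanish at \<open>t = b\<close> itself.
\<close>

lemma (in pinned_profile) exists_set_near_profile:
  assumes d: "d = real CARD('n)"
  obtains C :: "(real ^ 'n) set" and M where "compact C" "C \<noteq> {}" "C \<subseteq> unit_cube"
    "\<And>x. 0 \<le> x \<Longrightarrow> \<bar>log_covering C x - profile x\<bar> \<le> M"
    "\<And>x. \<lbrakk>x \<in> A; M < b * x\<rbrakk> \<Longrightarrow> log_covering C x < b * x"
proof -
  define K where "K = d * (ln d + 2 * ln 2)"
  have "1 \<le> d" by (simp add: d Suc_le_eq)
  then have K: "0 \<le> K" by (auto simp: K_def)
  define F where "F x = max 0 (profile x - K - 1)" for x
  have "\<exists>C :: (real ^ 'n) set. compact C \<and> C \<noteq> {} \<and> C \<subseteq> unit_cube \<and>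
    (\<forall>x\<ge>0. \<bar>log_covering C x - F x\<bar> \<le> K)"
    unfolding K_def d
  proof (rule exists_set_with_profile)
    show "F 0 = 0" using K by (simp add: F_def profile_0)
    fix x y :: real assume xy: "0 \<le> x" "x \<le> y"
    show "F x \<le> F y" using profile_mono[OF xy(2)] by (auto simp: F_def)
    have "0 \<le> d * (y - x)" using xy \<open>1 \<le> d\<close> by simp
    then show "F y \<le> F x + real CARD('n) * (y - x)"
      using profile_lipschitz[OF xy(2)] by (auto simp: F_def d)
  qed
  then obtain C :: "(real ^ 'n) set" where C: "compact C" "C \<noteq> {}" "C \<subseteq> unit_cube"
    and near: "\<And>x. 0 \<le> x \<Longrightarrow> \<bar>log_covering C x - F x\<bar> \<le> K"
    by blast
  show ?thesis
  proof (rule that[OF C, of "2 * K + 1"])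
    fix x :: real
    show "\<bar>log_covering C x - profile x\<bar> \<le> 2 * K + 1" if "0 \<le> x"
    proof -
      have "0 \<le> profile x" using profile_ge_line[OF that] b_pos that mult_nonneg_nonneg[of b x] by linarith
      then have "\<bar>F x - profile x\<bar> \<le> K + 1" using K by (auto simp: F_def)
      with near[OF that] show ?thesis by linarith
    qed
    show "log_covering C x < b * x" if "x \<in> A" "2 * K + 1 < b * x"
    proof -
      have "0 \<le> x" using A_pos[OF that(1)] by simp
      then show ?thesis
        using near[of x] profile_le_on[OF that(1)] that(2) K by (auto simp: F_def)
    qed
  qed
qed

section \<open>Factorial scales\<close>

lemma exists_large_fact: "\<exists>N. \<forall>n\<ge>N. r < real n \<and> r < (fact n :: real)"
proof -
  obtain N where N: "r < real N" using reals_Archimedean2 by blast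
  show ?thesis
  proof (intro exI allI impI)
    fix n assume "N \<le> n"
    then have "r < real n" using N by linarith
    moreover have "real n \<le> fact n"
      using fact_ge_self[of n] by (metis of_nat_fact of_nat_le_iff)
    ultimately show "r < real n \<and> r < (fact n :: real)" by linarith
  qed
qed

text \<open>
  The factorials have ratios tending to infinity.  Every second of the intervals between consecutive
  factorials is filled, so that both the filled intervals and the gaps become arbitrarily long on
  the logarithmic scale.
\<close>

definition fact_blocks :: "real set" where
  "fact_blocks = (\<Union>n. {fact (2 * n)..fact (2 * n + 1)})"

lemma range_fact_subset_blocks: "range fact \<subseteq> fact_blocks"
proof
  fix x :: real assume "x \<in> range fact"
  then obtain m where x: "x = fact m" by blast
  have "m = 2 * (m div 2) \<or> m = 2 * (m div 2) + 1" by presburger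
  then have "x \<in> {fact (2 * (m div 2))..fact (2 * (m div 2) + 1)}"
    unfolding x by (metis atLeastAtMost_iff fact_mono le_add1 order_refl)
  then show "x \<in> fact_blocks" unfolding fact_blocks_def by blast
qed

lemma fact_blocks_pos: "\<kappa> \<in> fact_blocks \<Longrightarrow> 0 < \<kappa>"
  by (auto simp: fact_blocks_def intro: less_le_trans[OF fact_gt_zero])

lemma range_fact_unbounded: "\<exists>\<kappa>\<in>range fact. r < (\<kappa> :: real)"
  using exists_large_fact[of r] by blast

lemma fact_blocks_gaps:
  assumes "1 < R"
  shows "\<exists>x>r. \<forall>\<kappa>\<in>fact_blocks. R * \<kappa> \<le> x \<or> R * x \<le> \<kappa>"
proof -
  obtain N where N: "\<And>n. N \<le> n \<Longrightarrow> max r (R * R) < real n \<and> max r (R * R) < fact n"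
    using exists_large_fact by blast
  define u :: real where "u = fact (2 * N + 1)"
  have u: "0 < u" "r < u" using N[of "2 * N + 1"] by (auto simp: u_def)
  have "R * R * u \<le> real (2 * N + 2) * u"
    using N[of "2 * N + 2"] u by (intro mult_right_mono) auto
  also have "\<dots> = fact (2 * N + 2)" by (simp add: u_def)
  finally have next_block: "R * (R * u) \<le> fact (2 * N + 2)" by (simp add: mult.assoc)
  show ?thesis
  proof (intro exI conjI ballI)
    \<comment> \<open>The witness \<open>R u\<close> is far from the end \<open>u\<close> of a block and from the start of the next block, which
      is at least \<open>R\<^sup>2 u\<close>.\<close>
    have "1 * u < R * u" using assms u by (intro mult_strict_right_mono)
    then show "r < R * u" using u(2) by linarith
    fix \<kappa> assume "\<kappa> \<in> fact_blocks"
    then obtain m where m: "fact (2 * m) \<le> \<kappa>" "\<kappa> \<le> fact (2 * m + 1)"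
      by (auto simp: fact_blocks_def)
    show "R * \<kappa> \<le> R * u \<or> R * (R * u) \<le> \<kappa>"
    proof (cases "m \<le> N")
      case True
      then have "(fact (2 * m + 1) :: real) \<le> u" unfolding u_def by (intro fact_mono) simp
      then show ?thesis using m(2) assms by (auto intro!: mult_left_mono)
    next
      case False
      then have "(fact (2 * N + 2) :: real) \<le> fact (2 * m)" by (intro fact_mono) simp
      then show ?thesis using m(1) next_block by linarith
    qed
  qed
qed

lemma fact_blocks_long:
  assumes "0 < \<epsilon>"
  shows "\<exists>x>r. {\<epsilon> * x..x} \<subseteq> fact_blocks"
proof -
  obtain N where N: "\<And>n. N \<le> n \<Longrightarrow> max r (1 / \<epsilon>) < real n \<and> max r (1 / \<epsilon>) < fact n"
    using exists_large_fact by blast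
  have "1 / \<epsilon> < real (2 * N + 1)" "r < fact (2 * N + 1)"
    using N[of "2 * N + 1"] by auto
  then have "1 \<le> \<epsilon> * real (2 * N + 1)"
    using assms by (simp add: divide_less_eq mult.commute)
  then have "1 * fact (2 * N) \<le> \<epsilon> * real (2 * N + 1) * fact (2 * N)"
    by (rule mult_right_mono) simp
  also have "\<dots> = \<epsilon> * fact (2 * N + 1)" by simp
  finally have "{\<epsilon> * fact (2 * N + 1)..fact (2 * N + 1)} \<subseteq> {fact (2 * N)..fact (2 * N + 1)}"
    by (intro atLeastatMost_subset_iff[THEN iffD2]) simp
  also have "\<dots> \<subseteq> fact_blocks"
    unfolding fact_blocks_def by blast
  finally have "{\<epsilon> * fact (2 * N + 1)..fact (2 * N + 1)} \<subseteq> fact_blocks" .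
  with \<open>r < fact (2 * N + 1)\<close> show ?thesis by blast
qed

lemma range_fact_sparse:
  "\<exists>r. \<forall>\<kappa>\<in>range fact. \<forall>\<kappa>'\<in>range fact. r < \<kappa>' \<and> \<kappa> < \<kappa>' \<longrightarrow> R * \<kappa> \<le> (\<kappa>' :: real)"
proof -
  obtain N where N: "\<And>n. N \<le> n \<Longrightarrow> R < real n" using exists_large_fact by blast
  show ?thesis
  proof (intro exI ballI impI)
    fix \<kappa> \<kappa>' :: real assume "\<kappa> \<in> range fact" "\<kappa>' \<in> range fact" and *: "fact N < \<kappa>' \<and> \<kappa> < \<kappa>'"
    then obtain m n where mn: "\<kappa> = fact m" "\<kappa>' = fact n" by blast
    have "m < n" "N < n"
      using * fact_mono[of n m, where 'a=real] fact_mono[of n N, where 'a=real] unfolding mn by (auto simp: not_less[symmetric])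
    then obtain k where k: "n = Suc k" "m \<le> k" by (cases n) auto
    have "R * fact m \<le> real n * fact m"
      using N[of n] \<open>N < n\<close> by (intro mult_right_mono) auto
    also have "\<dots> \<le> real n * fact k" using k by (intro mult_left_mono fact_mono) auto
    also have "\<dots> = fact n" by (simp add: k(1))
    finally show "R * \<kappa> \<le> \<kappa>'" unfolding mn .
  qed
qed

section \<open>Box dimensions in the unit cube\<close>

lemma upper_box_dim_le_dim:
  fixes C :: "(real ^ 'n) set"
  assumes C: "C \<subseteq> unit_cube" "C \<noteq> {}"
  shows "upper_box_dim C \<le> ereal (real CARD('n))"
  unfolding upper_box_dim_log
proof (rule Limsup_ereal_le)
  fix \<epsilon> :: real assume "0 < \<epsilon>"
  define c where "c = log_covering C 0 + real CARD('n) * ln (3 * real CARD('n))"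
  show "\<forall>\<^sub>F x in at_top. log_covering C x / x \<le> real CARD('n) + \<epsilon>"
    using eventually_gt_at_top[of "max 0 (c / \<epsilon>)"]
  proof eventually_elim
    case (elim x)
    then have "c < \<epsilon> * x" using \<open>0 < \<epsilon>\<close> by (simp add: divide_less_eq mult.commute)
    then have "log_covering C x \<le> (real CARD('n) + \<epsilon>) * x"
      using log_covering_growth[OF C, of 0 x] elim by (simp add: c_def algebra_simps)
    then show ?case using elim by (simp add: divide_le_eq)
  qed
qed

lemma upper_box_dim_unit_cube:
  "upper_box_dim (unit_cube :: (real ^ 'n) set) = ereal (real CARD('n))"
proof (rule antisym)
  have "(0 :: real ^ 'n) \<in> unit_cube" by simp
  then show "upper_box_dim (unit_cube :: (real ^ 'n) set) \<le> ereal (real CARD('n))"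
    by (intro upper_box_dim_le_dim) blast+
  define d where "d = real CARD('n)"
  have "\<exists>C :: (real ^ 'n) set. compact C \<and> C \<noteq> {} \<and> C \<subseteq> unit_cube \<and>
    (\<forall>x\<ge>0. \<bar>log_covering C x - d * x\<bar> \<le> d * (ln d + 2 * ln 2))"
    unfolding d_def by (rule exists_set_with_profile) (auto simp: algebra_simps)
  then obtain C :: "(real ^ 'n) set" where C: "C \<noteq> {}" "C \<subseteq> unit_cube"
    and near: "\<And>x. 0 \<le> x \<Longrightarrow> \<bar>log_covering C x - d * x\<bar> \<le> d * (ln d + 2 * ln 2)"
    by blast
  show "ereal (real CARD('n)) \<le> upper_box_dim (unit_cube :: (real ^ 'n) set)"
    unfolding upper_box_dim_log d_def[symmetric]
  proof (rule Limsup_ereal_ge)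
    fix \<epsilon> :: real assume "0 < \<epsilon>"
    show "\<exists>\<^sub>F x in at_top. d - \<epsilon> \<le> log_covering (unit_cube :: (real ^ 'n) set) x / x"
    proof (rule eventually_frequently)
      show "\<forall>\<^sub>F x in at_top. d - \<epsilon> \<le> log_covering (unit_cube :: (real ^ 'n) set) x / x"
        using eventually_gt_at_top[of "max 0 (d * (ln d + 2 * ln 2) / \<epsilon>)"]
      proof eventually_elim
        case (elim x)
        then have "d * (ln d + 2 * ln 2) < \<epsilon> * x" "0 < x"
          using \<open>0 < \<epsilon>\<close> by (simp_all add: divide_less_eq mult.commute)
        then have "(d - \<epsilon>) * x \<le> log_covering C x"
          using near[of x] by (simp add: left_diff_distrib)
        also have "\<dots> \<le> log_covering (unit_cube :: (real ^ 'n) set) x"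
          by (rule log_covering_mono[OF C(2) order_refl C(1) order_refl])
        finally show ?case using \<open>0 < x\<close> by (simp add: le_divide_eq)
      qed
    qed simp
  qed
qed

lemma cov_reg_exponent_unit_cube_log:
  fixes C :: "(real ^ 'n) set"
  assumes "C \<subseteq> unit_cube" "C \<noteq> {}"
  shows "cov_reg_exponent t C = Liminf at_top (\<lambda>x. ereal (regularity_at (log_covering C) t x))"
  by (rule cov_reg_exponent_log) (rule covering_number_unit_cube_pos[OF assms])

text \<open>
  The bound on the exponent, with the dimensions as real numbers.  The hypotheses force the lower
  dimension to be finite and \<open>t\<close> to lie strictly below the dimension of the cube.
\<close>

lemma cov_reg_exponent_le:
  fixes C :: "(real ^ 'n) set"
  assumes C: "C \<subseteq> unit_cube" "C \<noteq> {}"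
    and t: "lower_box_dim C < ereal t" "ereal t < upper_box_dim C"
  shows "\<exists>b. lower_box_dim C = ereal b \<and> 0 \<le> b \<and> b < t \<and> t < real CARD('n) \<and>
    cov_reg_exponent t C \<le> ereal (b / t * ((real CARD('n) - t) / (real CARD('n) - b)))"
proof -
  have "0 \<le> lower_box_dim C"
    unfolding lower_box_dim_log
  proof (rule Liminf_bounded)
    show "\<forall>\<^sub>F x in at_top. 0 \<le> ereal (log_covering C x / x)"
      using eventually_gt_at_top[of 0]
      by eventually_elim (simp add: log_covering_nonneg[OF C])
  qed
  then obtain b where b: "lower_box_dim C = ereal b"
    using t(1) by (cases "lower_box_dim C") auto
  have bt: "0 \<le> b" "b < t"
    using b \<open>0 \<le> lower_box_dim C\<close> t(1) by auto
  have td: "t < real CARD('n)"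
    using less_le_trans[OF t(2) upper_box_dim_le_dim[OF C]] by simp
  have "Liminf at_top (\<lambda>x. ereal (regularity_at (log_covering C) t x))
      \<le> ereal (b / t * ((real CARD('n) - t) / (real CARD('n) - b)))"
  proof (rule regularity_upper_bound)
    show "log_covering C x \<le> log_covering C y" if "x \<le> y" for x y
      using log_covering_mono[OF order_refl C that] .
    show "0 \<le> log_covering C 0" by (rule log_covering_nonneg[OF C])
    fix \<epsilon> :: real assume "0 < \<epsilon>"
    then have "Liminf at_top (\<lambda>x. ereal (log_covering C x / x)) < ereal (b + \<epsilon>)"
      using b by (simp add: lower_box_dim_log)
    then have "\<exists>\<^sub>F x in at_top. log_covering C x / x < b + \<epsilon>"
      by (rule Liminf_ereal_lessD)
    then have "\<exists>\<^sub>F x in at_top. log_covering C x / x < b + \<epsilon> \<and> 0 < x"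
      using eventually_gt_at_top[of 0] by (rule frequently_eventually_frequently)
    then show "\<exists>\<^sub>F x in at_top. log_covering C x < (b + \<epsilon>) * x"
      by (rule frequently_elim1) (simp add: divide_less_eq)
  qed (use bt td log_covering_growth[OF C] in auto)
  then show ?thesis
    unfolding cov_reg_exponent_unit_cube_log[OF C] using b bt td by blast
qed

theorem proposition2p10:
  fixes X :: "(real ^ 'n) set" and d :: real
  assumes X: "X = {x. \<forall>i. 0 \<le> x $ i \<and> x $ i \<le> 1}"
    and d: "d = real CARD('n)"
  shows
    "(\<forall>b B :: real. 0 < b \<and> b < B \<and> B \<le> d \<longrightarrow>
        (\<exists>C. compact C \<and> C \<noteq> {} \<and> C \<subseteq> X \<and>
             lower_box_dim C = ereal b \<and> upper_box_dim C = ereal B \<and>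
             (\<forall>t::real. t \<ge> b \<longrightarrow> cov_reg_exponent t C = 0)))
     \<and>
     (\<forall>b B :: real. 0 < b \<and> b < B \<and> B \<le> d \<longrightarrow>
        (\<exists>C. compact C \<and> C \<noteq> {} \<and> C \<subseteq> X \<and>
             lower_box_dim C = ereal b \<and> upper_box_dim C = ereal B \<and>
             (\<forall>t::real. b < t \<and> t < B \<longrightarrow>
                cov_reg_exponent t C = ereal (b / t * ((d - t) / (d - b)))) \<and>
             (\<forall>t::real. lower_box_dim C < ereal t \<and> ereal t < upper_box_dim C \<longrightarrow>
                cov_reg_exponent t C =
                  lower_box_dim C / ereal t *
                    ((upper_box_dim X - ereal t) / (upper_box_dim X - lower_box_dim C)))))
     \<and>
     (\<forall>C. compact C \<and> C \<noteq> {} \<and> C \<subseteq> X \<longrightarrow>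
        (\<forall>t::real. lower_box_dim C < ereal t \<and> ereal t < upper_box_dim C \<longrightarrow>
           cov_reg_exponent t C \<le>
             lower_box_dim C / ereal t *
               ((upper_box_dim X - ereal t) / (upper_box_dim X - lower_box_dim C))))"
proof (intro conjI allI impI)
  fix b B :: real
  assume bB: "0 < b \<and> b < B \<and> B \<le> d"
  interpret blocks: pinned_profile b B d fact_blocks
    using bB fact_blocks_pos range_fact_subset_blocks by unfold_locales auto
  obtain C :: "(real ^ 'n) set" and M where C: "compact C" "C \<noteq> {}" "C \<subseteq> X"
    and near: "\<And>x. 0 \<le> x \<Longrightarrow> \<bar>log_covering C x - blocks.profile x\<bar> \<le> M"
    and below: "\<And>x. \<lbrakk>x \<in> fact_blocks; M < b * x\<rbrakk> \<Longrightarrow> log_covering C x < b * x"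
    unfolding X by (rule blocks.exists_set_near_profile[OF d]) blast
  have low: "lower_box_dim C = ereal b"
    unfolding lower_box_dim_log using near
  proof (rule blocks.liminf_near_profile)
    show "\<exists>\<kappa>\<in>fact_blocks. r < \<kappa>" for r
      using range_fact_unbounded[of r] range_fact_subset_blocks by blast
  qed
  have up: "upper_box_dim C = ereal B"
    unfolding upper_box_dim_log using near fact_blocks_gaps
    by (rule blocks.limsup_near_profile)
  have "cov_reg_exponent t C = 0" if "b \<le> t" for t
    unfolding cov_reg_exponent_unit_cube_log[OF C(3)[unfolded X] C(2)]
  proof (rule regularity_vanishes)
    show "0 \<le> log_covering C 0"
      by (rule log_covering_nonneg[OF C(3)[unfolded X] C(2)])
    show "log_covering C x < b * x" if "x \<in> fact_blocks" "M / b < x" for x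
      using that bB by (intro below) (simp_all add: divide_less_eq mult.commute)
    show "\<exists>x>r. {\<epsilon> * x..x} \<subseteq> fact_blocks" if "0 < \<epsilon>" "\<epsilon> < 1" for \<epsilon> r
      using that by (intro fact_blocks_long)
  qed fact
  then show "\<exists>C. compact C \<and> C \<noteq> {} \<and> C \<subseteq> X \<and>
      lower_box_dim C = ereal b \<and> upper_box_dim C = ereal B \<and>
      (\<forall>t::real. t \<ge> b \<longrightarrow> cov_reg_exponent t C = 0)"
    using C low up by blast
next
  fix b B :: real
  assume bB: "0 < b \<and> b < B \<and> B \<le> d"
  interpret pinned: pinned_profile b B d "range fact"
    using bB by unfold_locales auto
  obtain C :: "(real ^ 'n) set" and M where C: "compact C" "C \<noteq> {}" "C \<subseteq> X"
    and near: "\<And>x. 0 \<le> x \<Longrightarrow> \<bar>log_covering C x - pinned.profile x\<bar> \<le> M"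
    unfolding X by (rule pinned.exists_set_near_profile[OF d]) blast
  have low: "lower_box_dim C = ereal b"
    unfolding lower_box_dim_log using near range_fact_unbounded
    by (rule pinned.liminf_near_profile)
  have up: "upper_box_dim C = ereal B"
    unfolding upper_box_dim_log using near
  proof (rule pinned.limsup_near_profile)
    show "\<exists>x>r. \<forall>\<kappa>\<in>range fact. R * \<kappa> \<le> x \<or> R * x \<le> \<kappa>" if "1 < R" for R r :: real
      using fact_blocks_gaps[OF that, of r] range_fact_subset_blocks by blast
  qed
  have reg: "cov_reg_exponent t C = ereal (b / t * ((d - t) / (d - b)))" if "b < t" "t < B" for t
  proof (rule antisym)
    show "cov_reg_exponent t C \<le> ereal (b / t * ((d - t) / (d - b)))"
      using cov_reg_exponent_le[OF C(3)[unfolded X] C(2), of t] that by (auto simp: low up d)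
    show "ereal (b / t * ((d - t) / (d - b))) \<le> cov_reg_exponent t C"
      unfolding cov_reg_exponent_unit_cube_log[OF C(3)[unfolded X] C(2)]
      using near range_fact_sparse that by (rule pinned.regularity_lower_bound)
  qed
  moreover have "cov_reg_exponent t C = lower_box_dim C / ereal t *
      ((upper_box_dim X - ereal t) / (upper_box_dim X - lower_box_dim C))"
    if "lower_box_dim C < ereal t \<and> ereal t < upper_box_dim C" for t
    using that reg[of t] bB by (simp add: low up X upper_box_dim_unit_cube d)
  ultimately show "\<exists>C. compact C \<and> C \<noteq> {} \<and> C \<subseteq> X \<and>
      lower_box_dim C = ereal b \<and> upper_box_dim C = ereal B \<and>
      (\<forall>t::real. b < t \<and> t < B \<longrightarrow>
         cov_reg_exponent t C = ereal (b / t * ((d - t) / (d - b)))) \<and>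
      (\<forall>t::real. lower_box_dim C < ereal t \<and> ereal t < upper_box_dim C \<longrightarrow>
         cov_reg_exponent t C =
           lower_box_dim C / ereal t *
             ((upper_box_dim X - ereal t) / (upper_box_dim X - lower_box_dim C)))"
    using C low up by blast
next
  fix C :: "(real ^ 'n) set" and t :: real
  assume C: "compact C \<and> C \<noteq> {} \<and> C \<subseteq> X"
    and t: "lower_box_dim C < ereal t \<and> ereal t < upper_box_dim C"
  then have "C \<subseteq> unit_cube" "C \<noteq> {}" by (auto simp: X)
  from cov_reg_exponent_le[OF this, of t] t
  obtain b where b: "lower_box_dim C = ereal b" "0 \<le> b" "b < t" "t < d"
    "cov_reg_exponent t C \<le> ereal (b / t * ((d - t) / (d - b)))"
    unfolding d by blast
  have "upper_box_dim X = ereal d"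
    unfolding X d by (rule upper_box_dim_unit_cube)
  then have "lower_box_dim C / ereal t *
      ((upper_box_dim X - ereal t) / (upper_box_dim X - lower_box_dim C))
      = ereal (b / t * ((d - t) / (d - b)))"
    using b(1-4) by simp
  with b(5) show "cov_reg_exponent t C \<le> lower_box_dim C / ereal t *
      ((upper_box_dim X - ereal t) / (upper_box_dim X - lower_box_dim C))"
    by simp
qed

end
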